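(* Assume that $1\le p\le 2$ and $\frac1p+\frac1{p'}=1$. Then there exists a constant $C_p\ge 1$ such that $$\|\widehat f\|_{l^{p'}(\mathcal U)}\le C_p\|f\|_{\mathcal H^p}\quad\text{and}\quad \|\mathcal F_{\mathcal U}^{-1}a\|_{\mathcal H^{p'}}\le C_p\|a\|_{l^p(\mathcal U)}$$ for all $f\in\mathcal H^p$ and $a\in l^p(\mathcal U)$. Similarly, $$\|\widehat f_{\ast}\|_{l^{p'}(\mathcal V)}\le C_p\|f\|_{\mathcal H^p}\quad\text{and}\quad \|\mathcal F_{\mathcal V}^{-1}b\|_{\mathcal H^{p'}}\le C_p\|b\|_{l^p(\mathcal V)}$$ for all $f\in\mathcal H^p$ and $b\in l^p(\mathcal V)$.
   Context: $\mathcal H$ is a separable complex Hilbert space with inner product $(\cdot,\cdot)=(\cdot,\cdot)_{\mathcal H}$, linear in the first argument. $I$ is a discrete (countable) index set. $\mathcal U=\{u_\xi\}_{\xi\in I}$ is a Riesz basis of $\mathcal H$, and $\mathcal V=\{v_\xi\}_{\xi\in I}\subset\mathcal H$ is the system biorthogonal to $\mathcal U$: $(u_\xi,v_\eta)=\delta_{\xi\eta}$; then $\mathcal V$ is also a Riesz basis of $\mathcal H$. For $f\in\mathcal H$, $\mathcal F_{\mathcal U}f(\xi)=\widehat f(\xi):=(f,v_\xi)$ and $\mathcal F_{\mathcal V}f(\xi)=\widehat f_{\ast}(\xi):=(f,u_\xi)$, with inverses $\mathcal F_{\mathcal U}^{-1}a=\sum_{\xi\in I}a(\xi)u_\xi$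 and $\mathcal F_{\mathcal V}^{-1}a=\sum_{\xi\in I}a(\xi)v_\xi$. Standing assumptions on $\mathcal H^p$: $\{\mathcal H^p\}_{1\le p\le\infty}$ is a family of Banach spaces with norms $\|\cdot\|_{\mathcal H^p}$ such that $\mathcal H^p\subseteq\mathcal H$, $\mathcal H^2=\mathcal H$, and $|(x,y)_{\mathcal H}|\le\|x\|_{\mathcal H^p}\|y\|_{\mathcal H^q}$ for all $x\in\mathcal H^p$, $y\in\mathcal H^q$, $1\le p\le\infty$, $\frac1p+\frac1q=1$. They satisfy the real interpolation properties (equality of spaces with equivalent norms) $$(\mathcal H^1,\mathcal H^2)_{\theta,p}=\mathcal H^p,\ 0<\theta<1,\ \tfrac1p=1-\tfrac\theta2;\qquad (\mathcal H^2,\mathcal H^\infty)_{\theta,p}=\mathcal H^p,\ 0<\theta<1,\ \tfrac1p=\tfrac{1-\theta}2 .$$ Also $\mathcal U\subset\mathcal H^p$ and $\mathcal V\subset\mathcal H^p$ for all $p\in[1,\infty]$. Spaces $l^p(\mathcal U)$: all $a:I\to\mathbb C$ with finite norm $$\|a\|_{l^p(\mathcal U)}=\Big(\sum_{\xi\in I}|a(\xi)|^p\|u_\xi\|_{\mathcal H^\infty}^{2-p}\Big)^{1/p}\ (1\le p\le2),\qquad \|a\|_{l^p(\mathcal U)}=\Big(\sum_{\xi\in I}|a(\xi)|^p\|v_\xi\|_{\mathcal H^\infty}^{2-p}\Big)^{1/p}\ (2\le p<\infty),$$ $\|a\|_{l^\infty(\mathcal U)}=\sup_{\xi\in I}|a(\xi)|\,\|v_\xi\|_{\mathcal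 H^\infty}^{-1}$. Spaces $l^p(\mathcal V)$ are defined by the same formulas with the roles of $u_\xi$ and $v_\xi$ interchanged: weight $\|v_\xi\|_{\mathcal H^\infty}^{2-p}$ for $1\le p\le2$, weight $\|u_\xi\|_{\mathcal H^\infty}^{2-p}$ for $2\le p<\infty$, and $\|b\|_{l^\infty(\mathcal V)}=\sup_{\xi\in I}|b(\xi)|\,\|u_\xi\|_{\mathcal H^\infty}^{-1}$. *)

theory Defs
  imports "HOL-Analysis.Analysis"
begin

text \<open>Complex Hilbert spaces; the inner product is linear in the first argument.\<close>

class complex_hilbert_space = banach +
  fixes scaleC :: "complex \<Rightarrow> 'a \<Rightarrow> 'a" (infixr "*\<^sub>C" 75)
    and cinner :: "'a \<Rightarrow> 'a \<Rightarrow> complex"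
  assumes scaleC_add_right: "c *\<^sub>C (x + y) = c *\<^sub>C x + c *\<^sub>C y"
    and scaleC_add_left: "(c + d) *\<^sub>C x = c *\<^sub>C x + d *\<^sub>C x"
    and scaleC_scaleC: "c *\<^sub>C d *\<^sub>C x = (c * d) *\<^sub>C x"
    and scaleR_scaleC: "scaleR r x = complex_of_real r *\<^sub>C x"
    and cinner_commute: "cinner x y = cnj (cinner y x)"
    and cinner_add_left: "cinner (x + y) z = cinner x z + cinner y z"
    and cinner_scaleC_left: "cinner (c *\<^sub>C x) y = c * cinner x y"
    and cinner_self: "cinner x x = complex_of_real ((norm x)\<^sup>2)"

lemma vector_space_scaleC:
  "vector_space (scaleC :: complex \<Rightarrow> 'h \<Rightarrow> 'h::complex_hilbert_space)"
proof
  fix x :: 'h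
  show "1 *\<^sub>C x = x"
    using scaleR_scaleC[of 1 x] by simp
qed (simp_all add: scaleC_add_right scaleC_add_left scaleC_scaleC)

text \<open>A Riesz basis is the image of an orthonormal basis under a bounded, boundedly invertible
  complex linear operator.\<close>

definition orthonormal_basis :: "'i set \<Rightarrow> ('i \<Rightarrow> 'h::complex_hilbert_space) \<Rightarrow> bool" where
  "orthonormal_basis I e \<longleftrightarrow>
     (\<forall>i\<in>I. \<forall>j\<in>I. cinner (e i) (e j) = (if i = j then 1 else 0)) \<and>
     closure (module.span scaleC (e ` I)) = UNIV"

definition bounded_clinear :: "('h::complex_hilbert_space \<Rightarrow> 'h) \<Rightarrow> bool" where
  "bounded_clinear T \<longleftrightarrow> bounded_linear T \<and> (\<forall>c x. T (c *\<^sub>C x) = c *\<^sub>C T x)"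

definition riesz_basis :: "'i set \<Rightarrow> ('i \<Rightarrow> 'h::complex_hilbert_space) \<Rightarrow> bool" where
  "riesz_basis I u \<longleftrightarrow>
     (\<exists>e T. orthonormal_basis I e \<and> bounded_clinear T \<and> bij T \<and> bounded_clinear (inv T) \<and>
            (\<forall>\<xi>\<in>I. u \<xi> = T (e \<xi>)))"

definition biorthogonal ::
  "'i set \<Rightarrow> ('i \<Rightarrow> 'h::complex_hilbert_space) \<Rightarrow> ('i \<Rightarrow> 'h) \<Rightarrow> bool" where
  "biorthogonal I u v \<longleftrightarrow>
     (\<forall>\<xi>\<in>I. \<forall>\<eta>\<in>I. cinner (u \<xi>) (v \<eta>) = (if \<xi> = \<eta> then 1 else 0))"

text \<open>Banach spaces contained (as sets) in an ambient space are represented by a carrier and a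
  norm; the values of the norm off the carrier are irrelevant.\<close>

definition banach_on :: "'h::complex_hilbert_space set \<Rightarrow> ('h \<Rightarrow> real) \<Rightarrow> bool" where
  "banach_on A n \<longleftrightarrow>
     module.subspace scaleC A \<and>
     (\<forall>x\<in>A. 0 \<le> n x \<and> (n x = 0 \<longleftrightarrow> x = 0)) \<and>
     (\<forall>x\<in>A. \<forall>y\<in>A. n (x + y) \<le> n x + n y) \<and>
     (\<forall>c. \<forall>x\<in>A. n (c *\<^sub>C x) = cmod c * n x) \<and>
     (\<forall>s. (\<forall>k. s k \<in> A) \<longrightarrow>
          (\<forall>\<epsilon>>0. \<exists>M. \<forall>j\<ge>M. \<forall>k\<ge>M. n (s j - s k) < \<epsilon>) \<longrightarrow>
          (\<exists>x\<in>A. (\<lambda>k. n (s k - x)) \<longlonglongrightarrow> (0::real)))"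

definition same_space ::
  "'h set \<Rightarrow> ('h \<Rightarrow> real) \<Rightarrow> 'h set \<Rightarrow> ('h \<Rightarrow> real) \<Rightarrow> bool" where
  "same_space A m B n \<longleftrightarrow>
     A = B \<and> (\<exists>c>0. \<exists>C>0. \<forall>x\<in>A. c * m x \<le> n x \<and> n x \<le> C * m x)"

text \<open>Real interpolation by the K-method, for a finite second parameter \<open>q\<close>:
  \<open>\<parallel>x\<parallel>\<^sup>q = \<integral> (t\<^sup>-\<^sup>\<theta> K(t,x))\<^sup>q dt/t\<close> over \<open>t > 0\<close>.\<close>

definition K_functional ::
  "'h::real_vector set \<Rightarrow> ('h \<Rightarrow> real) \<Rightarrow> 'h set \<Rightarrow> ('h \<Rightarrow> real) \<Rightarrow> real \<Rightarrow> 'h \<Rightarrow> real" where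
  "K_functional A m B n t x = Inf {m y + t * n z | y z. y \<in> A \<and> z \<in> B \<and> x = y + z}"

definition interp_integral ::
  "'h::real_vector set \<Rightarrow> ('h \<Rightarrow> real) \<Rightarrow> 'h set \<Rightarrow> ('h \<Rightarrow> real) \<Rightarrow> real \<Rightarrow> real \<Rightarrow> 'h \<Rightarrow> ennreal" where
  "interp_integral A m B n \<theta> q x =
     (\<integral>\<^sup>+t\<in>{0<..}. ennreal ((t powr (-\<theta>) * K_functional A m B n t x) powr q / t) \<partial>lborel)"

definition interp_space ::
  "'h::real_vector set \<Rightarrow> ('h \<Rightarrow> real) \<Rightarrow> 'h set \<Rightarrow> ('h \<Rightarrow> real) \<Rightarrow> real \<Rightarrow> real \<Rightarrow> 'h set" where
  "interp_space A m B n \<theta> q =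
     {x. (\<exists>y\<in>A. \<exists>z\<in>B. x = y + z) \<and> interp_integral A m B n \<theta> q x < \<infinity>}"

definition interp_norm ::
  "'h::real_vector set \<Rightarrow> ('h \<Rightarrow> real) \<Rightarrow> 'h set \<Rightarrow> ('h \<Rightarrow> real) \<Rightarrow> real \<Rightarrow> real \<Rightarrow> 'h \<Rightarrow> real" where
  "interp_norm A m B n \<theta> q x = enn2real (interp_integral A m B n \<theta> q x) powr (1 / q)"

text \<open>Exponents are extended nonnegative reals, so that \<open>1 / \<infinity> = 0\<close>;
  only the spaces with \<open>1 \<le> p\<close> matter. \<open>X p\<close> is the carrier and \<open>N p\<close> the norm of the space
  with exponent \<open>p\<close>.\<close>

locale hp_family =
  fixes X :: "ennreal \<Rightarrow> 'h::complex_hilbert_space set"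
    and N :: "ennreal \<Rightarrow> 'h \<Rightarrow> real"
  assumes banach: "1 \<le> p \<Longrightarrow> banach_on (X p) (N p)"
    and X_2: "X 2 = UNIV"
    and N_2: "N 2 x = norm x"
    and hoelder: "\<lbrakk>1 \<le> p; 1 \<le> q; 1 / p + 1 / q = 1; x \<in> X p; y \<in> X q\<rbrakk>
                  \<Longrightarrow> cmod (cinner x y) \<le> N p x * N q y"
    and interp_1_2: "\<lbrakk>0 < \<theta>; \<theta> < 1; 1 / r = 1 - \<theta> / 2\<rbrakk> \<Longrightarrow>
          same_space (interp_space (X 1) (N 1) (X 2) (N 2) \<theta> r)
                     (interp_norm (X 1) (N 1) (X 2) (N 2) \<theta> r)
                     (X (ennreal r)) (N (ennreal r))"
    and interp_2_inf: "\<lbrakk>0 < \<theta>; \<theta> < 1; 1 / r = (1 - \<theta>) / 2\<rbrakk> \<Longrightarrow>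
          same_space (interp_space (X 2) (N 2) (X \<infinity>) (N \<infinity>) \<theta> r)
                     (interp_norm (X 2) (N 2) (X \<infinity>) (N \<infinity>) \<theta> r)
                     (X (ennreal r)) (N (ennreal r))"

text \<open>The space \<open>l\<^sup>p(U)\<close> is \<open>lp_space I n u v p\<close> and \<open>l\<^sup>p(V)\<close> is \<open>lp_space I n v u p\<close>, where \<open>n\<close> is
  the norm with exponent \<open>\<infinity>\<close>. At \<open>p = 2\<close> the two cases of the weight agree
  (the weights are 1). Only the values of a sequence on \<open>I\<close> matter.\<close>

definition lp_term ::
  "('h \<Rightarrow> real) \<Rightarrow> ('i \<Rightarrow> 'h) \<Rightarrow> ('i \<Rightarrow> 'h) \<Rightarrow> ennreal \<Rightarrow> ('i \<Rightarrow> complex) \<Rightarrow> 'i \<Rightarrow> real" where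
  "lp_term n u v p a \<xi> =
     (if p = \<infinity> then cmod (a \<xi>) / n (v \<xi>)
      else cmod (a \<xi>) powr enn2real p *
           n (if p \<le> 2 then u \<xi> else v \<xi>) powr (2 - enn2real p))"

definition lp_space ::
  "'i set \<Rightarrow> ('h \<Rightarrow> real) \<Rightarrow> ('i \<Rightarrow> 'h) \<Rightarrow> ('i \<Rightarrow> 'h) \<Rightarrow> ennreal \<Rightarrow> ('i \<Rightarrow> complex) set" where
  "lp_space I n u v p =
     {a. if p = \<infinity> then bdd_above (lp_term n u v p a ` I) else lp_term n u v p a summable_on I}"

text \<open>The 0 inserted in the supremum only matters for empty \<open>I\<close>.\<close>

definition lp_norm ::
  "'i set \<Rightarrow> ('h \<Rightarrow> real) \<Rightarrow> ('i \<Rightarrow> 'h) \<Rightarrow> ('i \<Rightarrow> 'h) \<Rightarrow> ennreal \<Rightarrow> ('i \<Rightarrow> complex) \<Rightarrow> real" where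
  "lp_norm I n u v p a =
     (if p = \<infinity> then Sup (insert 0 (lp_term n u v p a ` I))
      else (\<Sum>\<^sub>\<infinity>\<xi>\<in>I. lp_term n u v p a \<xi>) powr (1 / enn2real p))"

text \<open>Coefficients are taken against the biorthogonal system: the transform associated with \<open>U\<close> is
  \<open>fourier v\<close> with inverse \<open>fourier_inv I u\<close>, the one associated with \<open>V\<close> is \<open>fourier u\<close> with
  inverse \<open>fourier_inv I v\<close>.\<close>

definition fourier :: "('i \<Rightarrow> 'h::complex_hilbert_space) \<Rightarrow> 'h \<Rightarrow> 'i \<Rightarrow> complex" where
  "fourier w f = (\<lambda>\<xi>. cinner f (w \<xi>))"

definition fourier_inv ::
  "'i set \<Rightarrow> ('i \<Rightarrow> 'h::complex_hilbert_space) \<Rightarrow> ('i \<Rightarrow> complex) \<Rightarrow> 'h" where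
  "fourier_inv I w a = (\<Sum>\<^sub>\<infinity>\<xi>\<in>I. a \<xi> *\<^sub>C w \<xi>)"

end

theory Submission
  imports Defs
begin

text \<open>
  Only the bounds for the synthesis maps \<open>a \<mapsto> \<Sum> a \<xi> u \<xi>\<close> from \<open>l\<^sup>p(U)\<close> to the space with exponent
  \<open>p'\<close> need work, and there only finite sums matter: by completeness and Hoelder's inequality
  against \<open>v \<xi>\<close>, the partial sums of a series converge to an element of that space whose
  coefficients are the \<open>a \<xi>\<close>, and this element is the sum of its expansion in the Riesz basis. For
  finite sums the endpoint \<open>p = 1\<close> is the triangle inequality and \<open>p = 2\<close> is the Riesz property.
  For \<open>1 < p < 2\<close> the K-functional between the exponents 2 and \<open>\<infinity>\<close> is estimated by an explicit
  splitting of the sum. The bounds for the coefficient maps follow by duality: the pairing of \<open>f\<close>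
  with a finite sum \<open>\<Sum> c \<xi> u \<xi>\<close> is controlled by Hoelder's inequality and the synthesis bound, and
  \<open>c\<close> is chosen to produce the \<open>p'\<close>-th powers of the coefficients of \<open>f\<close>.
\<close>

section \<open>Complex Hilbert spaces\<close>

lemma cinner_zero_left [simp]: "cinner 0 (y::'h::complex_hilbert_space) = 0"
  using cinner_add_left[of 0 0 y] by simp

lemma cinner_add_right:
  "cinner (x::'h::complex_hilbert_space) (y + z) = cinner x y + cinner x z"
  using cinner_add_left[of y z x] cinner_commute[of x] by (metis complex_cnj_add)

lemma cinner_scaleC_right:
  "cinner (x::'h::complex_hilbert_space) (c *\<^sub>C y) = cnj c * cinner x y"
  using cinner_scaleC_left[of c y x] cinner_commute[of x] by (metis complex_cnj_mult)

lemma scaleC_neg_one: "(- 1) *\<^sub>C (x::'h::complex_hilbert_space) = - x"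
  using scaleR_scaleC[of "-1" x] by simp

lemma scaleC_zero_left [simp]: "0 *\<^sub>C (x::'h::complex_hilbert_space) = 0"
  using scaleR_scaleC[of 0 x] by simp

lemma scaleC_zero_right [simp]: "c *\<^sub>C (0::'h::complex_hilbert_space) = 0"
  using scaleC_add_right[of c 0 0] by simp

lemma scaleC_sum_right:
  "c *\<^sub>C (\<Sum>i\<in>F. g i) = (\<Sum>i\<in>F. c *\<^sub>C (g i::'h::complex_hilbert_space))"
  by (induction F rule: infinite_finite_induct) (auto simp: scaleC_add_right)

lemma cinner_minus_left: "cinner (- x) (y::'h::complex_hilbert_space) = - cinner x y"
  using cinner_scaleC_left[of "-1" x y] by (simp add: scaleC_neg_one)

lemma cinner_diff_left:
  "cinner (x - y) (z::'h::complex_hilbert_space) = cinner x z - cinner y z"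
  using cinner_add_left[of x "- y" z] by (simp add: cinner_minus_left)

lemma cinner_sum_left:
  "cinner (\<Sum>i\<in>F. g i) (y::'h::complex_hilbert_space) = (\<Sum>i\<in>F. cinner (g i) y)"
  by (induction F rule: infinite_finite_induct) (auto simp: cinner_add_left)

lemma cinner_zero_right [simp]: "cinner (x::'h::complex_hilbert_space) 0 = 0"
  using cinner_add_right[of x 0 0] by simp

lemma cinner_sum_right:
  "cinner (x::'h::complex_hilbert_space) (\<Sum>i\<in>F. g i) = (\<Sum>i\<in>F. cinner x (g i))"
  by (induction F rule: infinite_finite_induct) (auto simp: cinner_add_right)

lemma cinner_self_eq_0: "cinner x x = 0 \<longleftrightarrow> (x::'h::complex_hilbert_space) = 0"
  by (simp add: cinner_self)

lemma norm_scaleC: "norm (c *\<^sub>C (x::'h::complex_hilbert_space)) = cmod c * norm x"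
proof -
  have "complex_of_real ((norm (c *\<^sub>C x))\<^sup>2) = (c * cnj c) * complex_of_real ((norm x)\<^sup>2)"
    unfolding cinner_self[symmetric] by (simp add: cinner_scaleC_left cinner_scaleC_right)
  also have "\<dots> = complex_of_real ((cmod c * norm x)\<^sup>2)"
    by (simp add: complex_norm_square[symmetric] power_mult_distrib)
  finally have "(norm (c *\<^sub>C x))\<^sup>2 = (cmod c * norm x)\<^sup>2"
    using of_real_eq_iff by blast
  then show ?thesis
    by (simp add: power2_eq_iff_nonneg)
qed

lemma cmod_cinner_le: "cmod (cinner x y) \<le> norm x * norm (y::'h::complex_hilbert_space)"
proof (cases "y = 0")
  case False
  \<comment> \<open>The coefficient of the orthogonal projection of \<open>x\<close> onto the line
    through \<open>y\<close>. Pythagoras then says that the projection is no longer than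
    \<open>x\<close>, which is Cauchy-Schwarz.\<close>
  define c where "c = cinner x y / complex_of_real ((norm y)\<^sup>2)"
  have c: "cinner x y = c * complex_of_real ((norm y)\<^sup>2)"
    using False by (simp add: c_def)
  have "cinner (x - c *\<^sub>C y) y = 0"
    by (simp add: cinner_diff_left cinner_scaleC_left cinner_self c)
  then have 1: "cinner (x - c *\<^sub>C y) (c *\<^sub>C y) = 0"
    by (simp add: cinner_scaleC_right)
  then have 2: "cinner (c *\<^sub>C y) (x - c *\<^sub>C y) = 0"
    using cinner_commute[of "c *\<^sub>C y" "x - c *\<^sub>C y"] by simp
  have "cinner x x = cinner ((x - c *\<^sub>C y) + c *\<^sub>C y) ((x - c *\<^sub>C y) + c *\<^sub>C y)"
    by simp
  also have "\<dots> = cinner (x - c *\<^sub>C y) (x - c *\<^sub>C y) + cinner (c *\<^sub>C y) (c *\<^sub>C y)"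
    by (simp only: cinner_add_left cinner_add_right 1 2 add_0 add_0_right)
  finally have "complex_of_real ((norm x)\<^sup>2)
      = complex_of_real ((norm (x - c *\<^sub>C y))\<^sup>2) + complex_of_real ((norm (c *\<^sub>C y))\<^sup>2)"
    by (simp only: cinner_self)
  then have "(norm x)\<^sup>2 = (norm (x - c *\<^sub>C y))\<^sup>2 + (norm (c *\<^sub>C y))\<^sup>2"
    unfolding of_real_add[symmetric] of_real_eq_iff .
  then have "(norm (c *\<^sub>C y))\<^sup>2 \<le> (norm x)\<^sup>2"
    using zero_le_power2[of "norm (x - c *\<^sub>C y)"] by linarith
  then have "norm (c *\<^sub>C y) \<le> norm x"
    by (rule power2_le_imp_le) simp
  then have "cmod c * norm y * norm y \<le> norm x * norm y"
    by (intro mult_right_mono) (auto simp: norm_scaleC)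
  then show ?thesis
    by (simp add: c norm_mult power2_eq_square norm_power mult.assoc)
qed simp

section \<open>Continuity of the inner product, density and unconditional summability\<close>

lemma bounded_linear_cinner_left: "bounded_linear (\<lambda>x. cinner x (y::'h::complex_hilbert_space))"
  by (rule bounded_linear_intro[where K = "norm y"])
     (auto simp: cinner_add_left scaleR_scaleC cinner_scaleC_left cmod_cinner_le
        scaleR_conv_of_real)

lemma bounded_linear_cinner_right: "bounded_linear (\<lambda>y. cinner (x::'h::complex_hilbert_space) y)"
  by (rule bounded_linear_intro[where K = "norm x"])
     (use cmod_cinner_le[of x] in \<open>auto simp: cinner_add_right scaleR_scaleC cinner_scaleC_right
        scaleR_conv_of_real mult.commute\<close>)

text \<open>Serves as an induction principle: a closed linear condition on vectors need only be
  checked on a set with dense span, such as an orthonormal basis.\<close>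

lemma closed_subspace_eq_UNIV:
  fixes S :: "'h::complex_hilbert_space set"
  assumes "closure (module.span scaleC B) = UNIV" "B \<subseteq> S" "closed S" "0 \<in> S"
    and "\<And>x y. x \<in> S \<Longrightarrow> y \<in> S \<Longrightarrow> x + y \<in> S"
    and "\<And>c x. x \<in> S \<Longrightarrow> c *\<^sub>C x \<in> S"
  shows "S = UNIV"
proof -
  have m: "module (scaleC :: complex \<Rightarrow> 'h \<Rightarrow> 'h)"
    using vector_space_scaleC by (simp add: module_iff_vector_space)
  have "module.subspace scaleC S"
    unfolding module.subspace_def[OF m] using assms by auto
  then have "module.span scaleC B \<subseteq> S"
    using module.span_minimal[OF m] assms(2) by auto
  then show ?thesis
    using closure_minimal[OF _ assms(3)] assms(1) by auto
qed

text \<open>The Cauchy criterion for unconditional sums: sums over finite supersets of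
  \<open>G\<close> lie within \<open>e / 2\<close> of the sum over \<open>G\<close>, hence within
  \<open>e\<close> of each other, and completeness supplies the limit.\<close>

lemma summable_on_if_tails_small:
  fixes f :: "'i \<Rightarrow> 'b::banach"
  assumes tails: "\<And>e. e > 0 \<Longrightarrow> \<exists>G. finite G \<and> G \<subseteq> A \<and>
    (\<forall>F. finite F \<and> F \<subseteq> A \<and> F \<inter> G = {} \<longrightarrow> norm (sum f F) < e)"
  shows "f summable_on A"
proof -
  have "\<exists>P. eventually P (finite_subsets_at_top A) \<and>
          (\<forall>F F'. P F \<and> P F' \<longrightarrow> dist (sum f F) (sum f F') < e)" if "e > 0" for e
  proof -
    have "0 < e / 2" using that by simp
    from tails[OF this] obtain G where G: "finite G" "G \<subseteq> A"
      "\<forall>F. finite F \<and> F \<subseteq> A \<and> F \<inter> G = {} \<longrightarrow> norm (sum f F) < e / 2"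
      by (elim exE conjE)
    let ?P = "\<lambda>F. finite F \<and> G \<subseteq> F \<and> F \<subseteq> A"
    have near: "dist (sum f F) (sum f G) < e / 2" if "?P F" for F
    proof -
      have "sum f F - sum f G = sum f (F - G)"
        using that by (simp add: sum_diff)
      moreover have "norm (sum f (F - G)) < e / 2"
        by (rule G(3)[rule_format]) (use that in auto)
      ultimately show ?thesis
        by (simp add: dist_norm)
    qed
    have "dist (sum f F) (sum f F') < e" if "?P F" "?P F'" for F F'
      using near[OF that(1)] near[OF that(2)] by (rule dist_triangle_half_l)
    moreover have "eventually ?P (finite_subsets_at_top A)"
      unfolding eventually_finite_subsets_at_top by (rule exI[of _ G]) (simp add: G(1,2))
    ultimately show ?thesis
      by (intro exI[of _ ?P]) simp
  qed
  then have "cauchy_filter (filtermap (sum f) (finite_subsets_at_top A))"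
    by (simp add: cauchy_filter_metric_filtermap)
  moreover have "complete (UNIV::'b set)"
    by (meson Cauchy_convergent UNIV_I complete_def convergent_def)
  ultimately obtain L where "(sum f \<longlongrightarrow> L) (finite_subsets_at_top A)"
    using complete_uniform[where S=UNIV] by (force simp add: filterlim_def)
  then show ?thesis
    using summable_on_def has_sum_def by blast
qed

section \<open>Riesz bases and their biorthogonal systems\<close>

text \<open>Analysis is adjoint to synthesis and inherits its bound: the vector synthesized from the
  coefficients of \<open>f\<close> pairs with \<open>f\<close> to the square of the left side, and
  one factor cancels.\<close>

lemma L2_analysis_le_if_synthesis_le:
  fixes w :: "'i \<Rightarrow> 'h::complex_hilbert_space"
  assumes K: "0 \<le> K"
    and "\<And>a. norm (\<Sum>\<xi>\<in>F. a \<xi> *\<^sub>C w \<xi>) \<le> K * L2_set (\<lambda>\<xi>. cmod (a \<xi>)) F"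
  shows "L2_set (\<lambda>\<xi>. cmod (cinner f (w \<xi>))) F \<le> K * norm f"
proof -
  let ?c = "\<lambda>\<xi>. cinner f (w \<xi>)" and ?L = "L2_set (\<lambda>\<xi>. cmod (cinner f (w \<xi>))) F"
  have "complex_of_real (?L\<^sup>2) = (\<Sum>\<xi>\<in>F. cnj (?c \<xi>) * ?c \<xi>)"
    unfolding L2_set_def
    by (simp add: sum_nonneg complex_norm_square mult.commute del: of_real_power)
  also have "\<dots> = cinner f (\<Sum>\<xi>\<in>F. ?c \<xi> *\<^sub>C w \<xi>)"
    by (simp add: cinner_sum_right cinner_scaleC_right)
  finally have "cmod (complex_of_real (?L\<^sup>2)) = cmod (cinner f (\<Sum>\<xi>\<in>F. ?c \<xi> *\<^sub>C w \<xi>))"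
    by (rule arg_cong)
  then have "?L\<^sup>2 = cmod (cinner f (\<Sum>\<xi>\<in>F. ?c \<xi> *\<^sub>C w \<xi>))"
    unfolding norm_of_real by simp
  also have "\<dots> \<le> norm f * (K * ?L)"
    using cmod_cinner_le assms(2) by (meson mult_left_mono norm_ge_zero order_trans)
  finally have *: "?L * ?L \<le> (K * norm f) * ?L"
    by (simp add: power2_eq_square algebra_simps)
  show ?thesis
  proof (cases "?L = 0")
    case True
    then show ?thesis using K by simp
  next
    case False
    then have "0 < ?L" by (simp add: order_less_le)
    with * show ?thesis by (rule mult_right_le_imp_le)
  qed
qed

text \<open>Collects what is kept of a Riesz basis and its biorthogonal system. The orthonormal
  basis and the operator behind it no longer appear, and both orders of the two systems turn out to
  be instances.\<close>

locale riesz_pair =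
  fixes I :: "'i set"
    and u v :: "'i \<Rightarrow> 'h::complex_hilbert_space"
    and K :: real
  assumes biorth: "\<lbrakk>\<xi> \<in> I; \<eta> \<in> I\<rbrakk> \<Longrightarrow> cinner (u \<xi>) (v \<eta>) = (if \<xi> = \<eta> then 1 else 0)"
    and total: "(\<And>\<xi>. \<xi> \<in> I \<Longrightarrow> cinner f (v \<xi>) = 0) \<Longrightarrow> f = 0"
    and K_nonneg: "0 \<le> K"
    and synthesis: "\<lbrakk>finite F; F \<subseteq> I\<rbrakk> \<Longrightarrow>
      norm (\<Sum>\<xi>\<in>F. a \<xi> *\<^sub>C u \<xi>) \<le> K * L2_set (\<lambda>\<xi>. cmod (a \<xi>)) F"
    and analysis: "\<lbrakk>finite F; F \<subseteq> I\<rbrakk> \<Longrightarrow>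
      L2_set (\<lambda>\<xi>. cmod (cinner f (v \<xi>))) F \<le> K * norm f"
begin

lemma cinner_sum_biorth:
  assumes "finite F" "F \<subseteq> I" "\<eta> \<in> I"
  shows "cinner (\<Sum>\<xi>\<in>F. a \<xi> *\<^sub>C u \<xi>) (v \<eta>) = (if \<eta> \<in> F then a \<eta> else 0)"
proof -
  have "cinner (\<Sum>\<xi>\<in>F. a \<xi> *\<^sub>C u \<xi>) (v \<eta>) = (\<Sum>\<xi>\<in>F. if \<xi> = \<eta> then a \<xi> else 0)"
    unfolding cinner_sum_left
    by (rule sum.cong) (use assms in \<open>auto simp: cinner_scaleC_left biorth subset_iff\<close>)
  then show ?thesis
    using assms(1) by (simp add: sum.delta)
qed

lemma u_neq_0:
  assumes "\<xi> \<in> I"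
  shows "u \<xi> \<noteq> 0"
proof
  assume "u \<xi> = 0"
  with biorth[OF assms assms] show False by simp
qed

text \<open>The analysis bound makes the squared coefficients summable; the synthesis bound turns
  small tails of that scalar series into small tails of the vector series.\<close>

lemma summable_on_expansion: "(\<lambda>\<xi>. cinner f (v \<xi>) *\<^sub>C u \<xi>) summable_on I"
proof (rule summable_on_if_tails_small)
  fix e :: real
  assume "e > 0"
  let ?c = "\<lambda>\<xi>. (cmod (cinner f (v \<xi>)))\<^sup>2"
  have "sum ?c F \<le> (K * norm f)\<^sup>2" if "finite F" "F \<subseteq> I" for F
    using power_mono[OF analysis[OF that, of f], of 2] by (simp add: L2_set_def sum_nonneg)
  then have summ: "?c summable_on I"
    by (intro nonneg_bdd_above_summable_on bdd_aboveI[where M = "(K * norm f)\<^sup>2"]) auto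
  \<comment> \<open>Chosen so that \<open>sqrt d\<close> is \<open>e / (K + 1)\<close>, which
    synthesis turns into less than \<open>e\<close>; adding 1 covers \<open>K = 0\<close>.\<close>
  define d where "d = (e / (K + 1))\<^sup>2"
  have "d > 0"
    using \<open>e > 0\<close> K_nonneg by (simp add: d_def)
  have "(sum ?c \<longlongrightarrow> infsum ?c I) (finite_subsets_at_top I)"
    using summ has_sum_def has_sum_infsum by blast
  then have "\<forall>\<^sub>F F in finite_subsets_at_top I. infsum ?c I - d < sum ?c F"
    by (rule order_tendstoD(1)) (use \<open>d > 0\<close> in simp)
  \<comment> \<open>\<open>G\<close> carries all but \<open>d\<close> of the total, which leaves
    less than \<open>d\<close> for any finite set disjoint from \<open>G\<close>.\<close>
  then obtain G where G: "finite G" "G \<subseteq> I" "infsum ?c I - d < sum ?c G"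
    unfolding eventually_finite_subsets_at_top by blast
  have "norm (\<Sum>\<xi>\<in>F. cinner f (v \<xi>) *\<^sub>C u \<xi>) < e"
    if F: "finite F" "F \<subseteq> I" "F \<inter> G = {}" for F
  proof -
    have "sum ?c F + sum ?c G = sum ?c (F \<union> G)"
      using F G by (simp add: sum.union_disjoint)
    also have "\<dots> \<le> infsum ?c I"
      by (rule finite_sum_le_infsum[OF summ]) (use F G in auto)
    finally have "sum ?c F < d"
      using G(3) by linarith
    then have "L2_set (\<lambda>\<xi>. cmod (cinner f (v \<xi>))) F < sqrt d"
      unfolding L2_set_def by simp
    also have "sqrt d = e / (K + 1)"
      using \<open>e > 0\<close> K_nonneg by (simp add: d_def)
    finally have small: "L2_set (\<lambda>\<xi>. cmod (cinner f (v \<xi>))) F < e / (K + 1)" .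
    have "norm (\<Sum>\<xi>\<in>F. cinner f (v \<xi>) *\<^sub>C u \<xi>)
        \<le> K * L2_set (\<lambda>\<xi>. cmod (cinner f (v \<xi>))) F"
      by (rule synthesis[OF F(1,2)])
    also have "\<dots> \<le> K * (e / (K + 1))"
      using small K_nonneg by (intro mult_left_mono) auto
    also have "\<dots> < e"
      using \<open>e > 0\<close> K_nonneg by (simp add: field_simps)
    finally show ?thesis .
  qed
  with G(1,2) show "\<exists>G. finite G \<and> G \<subseteq> I \<and> (\<forall>F. finite F \<and> F \<subseteq> I \<and> F \<inter> G = {} \<longrightarrow>
      norm (\<Sum>\<xi>\<in>F. cinner f (v \<xi>) *\<^sub>C u \<xi>) < e)"
    by (intro exI[of _ G]) simp
qed

text \<open>Pairing with \<open>v \<eta>\<close> is continuous, so the sum of the series has the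
  same coefficients as \<open>f\<close>; totality then identifies the two.\<close>

lemma has_sum_expansion: "((\<lambda>\<xi>. cinner f (v \<xi>) *\<^sub>C u \<xi>) has_sum f) I"
proof -
  let ?t = "\<lambda>\<xi>. cinner f (v \<xi>) *\<^sub>C u \<xi>"
  define g where "g = infsum ?t I"
  have g: "(?t has_sum g) I"
    using summable_on_expansion by (simp add: g_def)
  have "cinner (f - g) (v \<eta>) = 0" if "\<eta> \<in> I" for \<eta>
  proof -
    have "((\<lambda>\<xi>. cinner (?t \<xi>) (v \<eta>)) has_sum cinner g (v \<eta>)) I"
      by (rule has_sum_bounded_linear[OF bounded_linear_cinner_left g])
    moreover have "((\<lambda>\<xi>. cinner (?t \<xi>) (v \<eta>)) has_sum cinner f (v \<eta>)) I"
    proof (rule has_sum_finite_neutralI[where B = "{\<eta>}"])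
      show "cinner f (v \<eta>) = (\<Sum>\<xi>\<in>{\<eta>}. cinner (?t \<xi>) (v \<eta>))"
        using that by (simp add: cinner_scaleC_left biorth)
    qed (use that in \<open>auto simp: cinner_scaleC_left biorth\<close>)
    ultimately have "cinner g (v \<eta>) = cinner f (v \<eta>)"
      using has_sum_unique by blast
    then show ?thesis
      by (simp add: cinner_diff_left)
  qed
  then have "f - g = 0"
    by (rule total)
  with g show ?thesis
    by simp
qed

end

section \<open>Orthonormal bases and their images under isomorphisms\<close>

lemma L2_synthesis_orthonormal:
  fixes e :: "'i \<Rightarrow> 'h::complex_hilbert_space"
  assumes "orthonormal_basis I e" "finite F" "F \<subseteq> I"
  shows "norm (\<Sum>\<xi>\<in>F. a \<xi> *\<^sub>C e \<xi>) = L2_set (\<lambda>\<xi>. cmod (a \<xi>)) F"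
proof -
  have e: "cinner (e \<xi>) (e \<eta>) = (if \<xi> = \<eta> then 1 else 0)" if "\<xi> \<in> F" "\<eta> \<in> F" for \<xi> \<eta>
    using assms that by (auto simp: orthonormal_basis_def subset_iff)
  have "complex_of_real ((norm (\<Sum>\<xi>\<in>F. a \<xi> *\<^sub>C e \<xi>))\<^sup>2)
      = (\<Sum>\<eta>\<in>F. cnj (a \<eta>) * (\<Sum>\<xi>\<in>F. a \<xi> * (if \<xi> = \<eta> then 1 else 0)))"
    unfolding cinner_self[symmetric] cinner_sum_left cinner_sum_right
      cinner_scaleC_left cinner_scaleC_right
    by (intro sum.cong arg_cong2[where f = "(*)"]) (auto simp: e)
  also have "\<dots> = (\<Sum>\<eta>\<in>F. cnj (a \<eta>) * a \<eta>)"
    using assms(2) by (intro sum.cong refl) (simp add: if_distrib sum.delta cong: if_cong)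
  also have "\<dots> = complex_of_real (\<Sum>\<xi>\<in>F. (cmod (a \<xi>))\<^sup>2)"
    by (simp add: complex_norm_square mult.commute del: of_real_power)
  finally have "(norm (\<Sum>\<xi>\<in>F. a \<xi> *\<^sub>C e \<xi>))\<^sup>2 = (\<Sum>\<xi>\<in>F. (cmod (a \<xi>))\<^sup>2)"
    unfolding of_real_eq_iff .
  then show ?thesis
    unfolding L2_set_def by (metis norm_ge_zero real_sqrt_unique)
qed

text \<open>The vectors orthogonal to \<open>f\<close> form a closed subspace containing the basis,
  hence the whole space and in particular \<open>f\<close>.\<close>

lemma orthonormal_basis_total:
  fixes e :: "'i \<Rightarrow> 'h::complex_hilbert_space"
  assumes e: "orthonormal_basis I e" and f: "\<And>\<xi>. \<xi> \<in> I \<Longrightarrow> cinner f (e \<xi>) = 0"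
  shows "f = 0"
proof -
  have "{h. cinner f h = 0} = UNIV"
  proof (rule closed_subspace_eq_UNIV[where B = "e ` I"])
    have "continuous_on UNIV (\<lambda>h. cinner f h)"
      by (intro linear_continuous_on bounded_linear_cinner_right)
    then show "closed {h. cinner f h = 0}"
      by (intro closed_Collect_eq) auto
  qed (use assms in \<open>auto simp: orthonormal_basis_def cinner_add_right cinner_scaleC_right\<close>)
  then have "cinner f f = 0"
    by blast
  then show ?thesis
    by (simp add: cinner_self_eq_0)
qed

text \<open>Synthesis by \<open>u\<close> is bounded through \<open>T\<close> and analysis by
  \<open>v\<close> through its inverse. Duality gives the other two bounds: analysis by
  \<open>u\<close> from synthesis by \<open>u\<close>, and synthesis by \<open>v\<close> from
  analysis by \<open>v\<close>.\<close>

proposition riesz_basis_riesz_pairs: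
  fixes u v :: "'i \<Rightarrow> 'h::complex_hilbert_space"
  assumes "riesz_basis I u" and biorth: "biorthogonal I u v"
  obtains K where "riesz_pair I u v K" "riesz_pair I v u K"
proof -
  obtain e T where e: "orthonormal_basis I e" and T: "bounded_clinear T" "bij T"
    and T': "bounded_clinear (inv T)" and u: "\<And>\<xi>. \<xi> \<in> I \<Longrightarrow> u \<xi> = T (e \<xi>)"
    using assms(1) unfolding riesz_basis_def by blast
  have T_inv [simp]: "T (inv T x) = x" "inv T (T x) = x" for x
    using T(2) by (simp_all add: bij_is_surj surj_f_inv_f bij_is_inj)
  interpret T: bounded_linear T
    using T(1) by (simp add: bounded_clinear_def)
  interpret T': bounded_linear "inv T"
    using T' by (simp add: bounded_clinear_def)
  have Tc: "T (c *\<^sub>C x) = c *\<^sub>C T x" for c x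
    using T(1) by (simp add: bounded_clinear_def)
  define K where "K = max (onorm T) (onorm (inv T))"
  have K0: "0 \<le> K"
    using onorm_pos_le[OF T.bounded_linear] by (simp add: K_def)
  have TK: "norm (T x) \<le> K * norm x" "norm (inv T x) \<le> K * norm x" for x
    using onorm[OF T.bounded_linear, of x] onorm[OF T'.bounded_linear, of x]
      mult_right_mono[of "onorm T" K "norm x"] mult_right_mono[of "onorm (inv T)" K "norm x"]
    by (auto simp: K_def)
  have uv: "cinner (u \<xi>) (v \<eta>) = (if \<xi> = \<eta> then 1 else 0)" if "\<xi> \<in> I" "\<eta> \<in> I" for \<xi> \<eta>
    using biorth that by (simp add: biorthogonal_def)
  have vu: "cinner (v \<xi>) (u \<eta>) = (if \<xi> = \<eta> then 1 else 0)" if "\<xi> \<in> I" "\<eta> \<in> I" for \<xi> \<eta>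
    using uv[OF that(2,1)] cinner_commute[of "v \<xi>" "u \<eta>"] by auto
  \<comment> \<open>Says that the adjoint of \<open>T\<close> maps \<open>v \<xi>\<close> to
    \<open>e \<xi>\<close>, without constructing the adjoint: both sides are continuous and linear
    in \<open>h\<close> and agree on the basis by biorthogonality.\<close>
  have Tv: "cinner (T h) (v \<xi>) = cinner h (e \<xi>)" if "\<xi> \<in> I" for h \<xi>
  proof -
    have "{h. cinner (T h) (v \<xi>) = cinner h (e \<xi>)} = UNIV"
    proof (rule closed_subspace_eq_UNIV[where B = "e ` I"])
      have "continuous_on UNIV (\<lambda>h. cinner (T h) (v \<xi>))" "continuous_on UNIV (\<lambda>h. cinner h (e \<xi>))"
        by (intro linear_continuous_on bounded_linear_cinner_left
            bounded_linear_compose[OF bounded_linear_cinner_left T.bounded_linear])+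
      then show "closed {h. cinner (T h) (v \<xi>) = cinner h (e \<xi>)}"
        by (rule closed_Collect_eq)
      show "e ` I \<subseteq> {h. cinner (T h) (v \<xi>) = cinner h (e \<xi>)}"
        using uv[OF _ that] e that by (auto simp: orthonormal_basis_def u[symmetric])
    qed (use e in \<open>auto simp: orthonormal_basis_def T.zero T.add Tc cinner_add_left
        cinner_scaleC_left\<close>)
    then show ?thesis
      by blast
  qed
  then have v_coeff: "cinner f (v \<xi>) = cinner (inv T f) (e \<xi>)" if "\<xi> \<in> I" for f \<xi>
    using Tv[OF that, of "inv T f"] by simp
  have synth_u: "norm (\<Sum>\<xi>\<in>F. a \<xi> *\<^sub>C u \<xi>) \<le> K * L2_set (\<lambda>\<xi>. cmod (a \<xi>)) F"
    if "finite F" "F \<subseteq> I" for F and a :: "'i \<Rightarrow> complex"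
  proof -
    have "(\<Sum>\<xi>\<in>F. a \<xi> *\<^sub>C u \<xi>) = T (\<Sum>\<xi>\<in>F. a \<xi> *\<^sub>C e \<xi>)"
      unfolding T.sum Tc by (rule sum.cong) (use that u in auto)
    then show ?thesis
      using TK(1)[of "\<Sum>\<xi>\<in>F. a \<xi> *\<^sub>C e \<xi>"] by (simp add: L2_synthesis_orthonormal[OF e that])
  qed
  have anal_v: "L2_set (\<lambda>\<xi>. cmod (cinner f (v \<xi>))) F \<le> K * norm f"
    if "finite F" "F \<subseteq> I" for F f
  proof -
    have "L2_set (\<lambda>\<xi>. cmod (cinner f (v \<xi>))) F = L2_set (\<lambda>\<xi>. cmod (cinner (inv T f) (e \<xi>))) F"
      by (rule L2_set_cong) (use that v_coeff in auto)
    also have "\<dots> \<le> 1 * norm (inv T f)"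
      by (rule L2_analysis_le_if_synthesis_le) (simp_all add: L2_synthesis_orthonormal[OF e that])
    finally show ?thesis
      using TK(2)[of f] by linarith
  qed
  have anal_u: "L2_set (\<lambda>\<xi>. cmod (cinner f (u \<xi>))) F \<le> K * norm f"
    if "finite F" "F \<subseteq> I" for F f
    by (rule L2_analysis_le_if_synthesis_le[OF K0 synth_u[OF that]])
  have synth_v: "norm (\<Sum>\<xi>\<in>F. a \<xi> *\<^sub>C v \<xi>) \<le> K * L2_set (\<lambda>\<xi>. cmod (a \<xi>)) F"
    if F: "finite F" "F \<subseteq> I" for F and a :: "'i \<Rightarrow> complex"
  proof -
    let ?g = "\<Sum>\<xi>\<in>F. a \<xi> *\<^sub>C v \<xi>"
    \<comment> \<open>Expanding only the second argument of \<open>(?g, ?g)\<close> leaves the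
      coefficients of \<open>?g\<close> against \<open>v\<close>, to which the analysis bound
      applies; one factor \<open>norm ?g\<close> then cancels.\<close>
    have "(norm ?g)\<^sup>2 = cmod (cinner ?g ?g)"
      by (simp only: cinner_self norm_of_real) simp
    also have "\<dots> = cmod (\<Sum>\<xi>\<in>F. cnj (a \<xi>) * cinner ?g (v \<xi>))"
      using cinner_sum_right[of ?g "\<lambda>\<xi>. a \<xi> *\<^sub>C v \<xi>" F] by (simp only: cinner_scaleC_right)
    also have "\<dots> \<le> (\<Sum>\<xi>\<in>F. \<bar>cmod (a \<xi>)\<bar> * \<bar>cmod (cinner ?g (v \<xi>))\<bar>)"
      by (rule sum_norm_le) (simp add: norm_mult)
    also have "\<dots> \<le> L2_set (\<lambda>\<xi>. cmod (a \<xi>)) F * L2_set (\<lambda>\<xi>. cmod (cinner ?g (v \<xi>))) F"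
      by (rule L2_set_mult_ineq)
    also have "\<dots> \<le> L2_set (\<lambda>\<xi>. cmod (a \<xi>)) F * (K * norm ?g)"
      by (rule mult_left_mono[OF anal_v[OF F] L2_set_nonneg])
    finally have *: "norm ?g * norm ?g \<le> (K * L2_set (\<lambda>\<xi>. cmod (a \<xi>)) F) * norm ?g"
      by (simp only: power2_eq_square mult_ac)
    show ?thesis
    proof (cases "norm ?g = 0")
      case True
      then show ?thesis
        using K0 L2_set_nonneg[of "\<lambda>\<xi>. cmod (a \<xi>)" F] by (simp only: mult_nonneg_nonneg)
    next
      case False
      then have "0 < norm ?g"
        by (simp only: norm_ge_zero order_less_le) simp
      with * show ?thesis
        by (rule mult_right_le_imp_le)
    qed
  qed
  have total_v: "f = 0" if "\<And>\<xi>. \<xi> \<in> I \<Longrightarrow> cinner f (v \<xi>) = 0" for f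
  proof -
    have "inv T f = 0"
      by (rule orthonormal_basis_total[OF e]) (simp add: that flip: v_coeff)
    then show ?thesis
      using T_inv(1)[of f] by (simp add: T.zero)
  qed
  have total_u: "f = 0" if f: "\<And>\<xi>. \<xi> \<in> I \<Longrightarrow> cinner f (u \<xi>) = 0" for f
  proof -
    \<comment> \<open>\<open>f\<close> is orthogonal to every \<open>T (e \<xi>)\<close>, hence by
      density to the range of \<open>T\<close>, which contains \<open>f\<close>.\<close>
    have "{h. cinner f (T h) = 0} = UNIV"
    proof (rule closed_subspace_eq_UNIV[where B = "e ` I"])
      have "continuous_on UNIV (\<lambda>h. cinner f (T h))"
        by (intro linear_continuous_on
            bounded_linear_compose[OF bounded_linear_cinner_right T.bounded_linear])
      then show "closed {h. cinner f (T h) = 0}"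
        by (intro closed_Collect_eq) auto
    qed (use e in \<open>auto simp: orthonormal_basis_def T.zero T.add Tc cinner_add_right
        cinner_scaleC_right f simp flip: u\<close>)
    then have "cinner f (T (inv T f)) = 0"
      by blast
    then show ?thesis
      by (simp add: cinner_self_eq_0)
  qed
  have "riesz_pair I u v K"
    by (unfold_locales) (use uv total_v K0 synth_u anal_v in auto)
  moreover have "riesz_pair I v u K"
    by (unfold_locales) (use vu total_u K0 synth_v anal_u in auto)
  ultimately show thesis
    by (rule that)
qed

section \<open>The spaces \<open>H\<^sup>p\<close>\<close>

context hp_family
begin

lemma module_scaleC: "module (scaleC :: complex \<Rightarrow> 'h \<Rightarrow> 'h)"
  using vector_space_scaleC by (simp add: module_iff_vector_space)

lemma X_subspace: "1 \<le> p \<Longrightarrow> module.subspace scaleC (X p)"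
  using banach by (simp add: banach_on_def)

lemma X_zero: "1 \<le> p \<Longrightarrow> 0 \<in> X p"
  using X_subspace module.subspace_0[OF module_scaleC] by blast

lemma X_add: "\<lbrakk>1 \<le> p; x \<in> X p; y \<in> X p\<rbrakk> \<Longrightarrow> x + y \<in> X p"
  using X_subspace module.subspace_add[OF module_scaleC] by blast

lemma X_scaleC: "\<lbrakk>1 \<le> p; x \<in> X p\<rbrakk> \<Longrightarrow> c *\<^sub>C x \<in> X p"
  using X_subspace module.subspace_scale[OF module_scaleC] by blast

lemma X_sum: "\<lbrakk>1 \<le> p; \<And>i. i \<in> F \<Longrightarrow> g i \<in> X p\<rbrakk> \<Longrightarrow> (\<Sum>i\<in>F. g i) \<in> X p"
  by (induction F rule: infinite_finite_induct) (auto intro: X_zero X_add)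

lemma X_diff: "\<lbrakk>1 \<le> p; x \<in> X p; y \<in> X p\<rbrakk> \<Longrightarrow> x - y \<in> X p"
  using X_subspace module.subspace_diff[OF module_scaleC] by blast

lemma N_nonneg: "\<lbrakk>1 \<le> p; x \<in> X p\<rbrakk> \<Longrightarrow> 0 \<le> N p x"
  using banach by (simp add: banach_on_def)

lemma N_eq_0_iff: "\<lbrakk>1 \<le> p; x \<in> X p\<rbrakk> \<Longrightarrow> N p x = 0 \<longleftrightarrow> x = 0"
  using banach by (simp add: banach_on_def)

lemma N_triangle: "\<lbrakk>1 \<le> p; x \<in> X p; y \<in> X p\<rbrakk> \<Longrightarrow> N p (x + y) \<le> N p x + N p y"
  using banach by (simp add: banach_on_def)

lemma N_scaleC: "\<lbrakk>1 \<le> p; x \<in> X p\<rbrakk> \<Longrightarrow> N p (c *\<^sub>C x) = cmod c * N p x"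
  using banach by (simp add: banach_on_def)

lemma N_minus_commute:
  assumes "1 \<le> p" "x \<in> X p" "y \<in> X p"
  shows "N p (x - y) = N p (y - x)"
  using N_scaleC[OF assms(1) X_diff[OF assms(1,3,2)], of "-1"] by (simp add: scaleC_neg_one)

lemma N_sum:
  assumes "1 \<le> p" "finite F" "\<And>i. i \<in> F \<Longrightarrow> g i \<in> X p"
  shows "N p (\<Sum>i\<in>F. g i) \<le> (\<Sum>i\<in>F. N p (g i))"
  using assms(2,3)
proof (induction F)
  case empty
  then show ?case
    using N_eq_0_iff[OF assms(1) X_zero[OF assms(1)]] by simp
next
  case (insert i F)
  have "N p (g i + (\<Sum>i\<in>F. g i)) \<le> N p (g i) + N p (\<Sum>i\<in>F. g i)"
    by (rule N_triangle) (use insert.prems assms(1) in \<open>auto intro: X_sum\<close>)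
  with insert show ?case
    by simp
qed

lemma N_complete:
  assumes "1 \<le> p" "\<And>k. s k \<in> X p"
    and "\<And>\<epsilon>. \<epsilon> > 0 \<Longrightarrow> \<exists>M. \<forall>j\<ge>M. \<forall>k\<ge>M. N p (s j - s k) < \<epsilon>"
  obtains x where "x \<in> X p" "(\<lambda>k. N p (s k - x)) \<longlonglongrightarrow> 0"
proof -
  have "(\<forall>k. s k \<in> X p) \<longrightarrow> (\<forall>\<epsilon>>0. \<exists>M. \<forall>j\<ge>M. \<forall>k\<ge>M. N p (s j - s k) < \<epsilon>) \<longrightarrow>
      (\<exists>x\<in>X p. (\<lambda>k. N p (s k - x)) \<longlonglongrightarrow> 0)"
    using banach[OF assms(1)] unfolding banach_on_def by (elim conjE) (erule spec)
  with assms(2,3) have "\<exists>x\<in>X p. (\<lambda>k. N p (s k - x)) \<longlonglongrightarrow> 0"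
    by simp
  then show thesis
    using that by (elim bexE)
qed

end

text \<open>Countability of \<open>I\<close> gives partial sums along a sequence; membership of
  \<open>v\<close> in every space lets coefficients be read off by Hoelder's inequality.\<close>

locale riesz_hp = hp_family X N + riesz_pair I u v K
  for X :: "ennreal \<Rightarrow> 'h::complex_hilbert_space set"
    and N :: "ennreal \<Rightarrow> 'h \<Rightarrow> real"
    and I :: "'i set" and u v :: "'i \<Rightarrow> 'h" and K :: real +
  assumes countable_I: "countable I"
    and u_mem: "\<lbrakk>1 \<le> q; \<xi> \<in> I\<rbrakk> \<Longrightarrow> u \<xi> \<in> X q"
    and v_mem: "\<lbrakk>1 \<le> q; \<xi> \<in> I\<rbrakk> \<Longrightarrow> v \<xi> \<in> X q"
begin

lemma N_inf_u_pos: "\<xi> \<in> I \<Longrightarrow> 0 < N \<infinity> (u \<xi>)"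
  using N_nonneg[of \<infinity> "u \<xi>"] N_eq_0_iff[of \<infinity> "u \<xi>"] u_mem[of \<infinity> \<xi>] u_neq_0[of \<xi>]
  by (simp add: order_less_le)

lemma N_inf_v_pos: "\<xi> \<in> I \<Longrightarrow> 0 < N \<infinity> (v \<xi>)"
proof -
  assume \<xi>: "\<xi> \<in> I"
  then have "v \<xi> \<noteq> 0"
    using biorth[OF \<xi> \<xi>] by auto
  then show ?thesis
    using N_nonneg[of \<infinity> "v \<xi>"] N_eq_0_iff[of \<infinity> "v \<xi>"] v_mem[of \<infinity> \<xi>] \<xi>
    by (simp add: order_less_le)
qed

lemma sum_u_mem: "\<lbrakk>1 \<le> q; F \<subseteq> I\<rbrakk> \<Longrightarrow> (\<Sum>\<xi>\<in>F. a \<xi> *\<^sub>C u \<xi>) \<in> X q"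
  by (intro X_sum X_scaleC u_mem) auto

subsection \<open>From finite sums to series\<close>

text \<open>Convergence in \<open>X q\<close> along one enumeration of \<open>I\<close> suffices:
  the limit is identified by its coefficients, and unconditional summability then comes from its own
  expansion in the Riesz basis.\<close>

lemma series_in_hp:
  fixes f :: "'i \<Rightarrow> real"
  assumes q: "1 \<le> q" "1 \<le> p" "1 / q + 1 / p = 1" and r: "0 < r" and C: "0 \<le> C"
    and fin: "\<And>F. finite F \<Longrightarrow> F \<subseteq> I \<Longrightarrow>
      N q (\<Sum>\<xi>\<in>F. a \<xi> *\<^sub>C u \<xi>) \<le> C * (\<Sum>\<xi>\<in>F. f \<xi>) powr (1 / r)"
    and f: "\<And>\<xi>. 0 \<le> f \<xi>" "f summable_on I"
  shows "(\<lambda>\<xi>. a \<xi> *\<^sub>C u \<xi>) summable_on I" "fourier_inv I u a \<in> X q"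
    "N q (fourier_inv I u a) \<le> C * (\<Sum>\<^sub>\<infinity>\<xi>\<in>I. f \<xi>) powr (1 / r)"
proof -
  \<comment> \<open>Initial segments of an enumeration of \<open>I\<close>, since completeness of
    \<open>X q\<close> is phrased for sequences. The bound \<open>fin\<close> on
    \<open>F j - F k\<close> makes \<open>s\<close> Cauchy because \<open>S\<close> is.\<close>
  define F where "F k = {\<xi> \<in> I. to_nat_on I \<xi> < k}" for k
  have F_fin: "finite (F k)" for k
  proof (rule finite_imageD)
    show "finite (to_nat_on I ` F k)"
      by (rule finite_subset[of _ "{..<k}"]) (auto simp: F_def)
    show "inj_on (to_nat_on I) (F k)"
      using inj_on_to_nat_on[OF countable_I] by (rule inj_on_subset) (auto simp: F_def)
  qed
  have F_sub: "F k \<subseteq> I" for k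
    by (auto simp: F_def)
  have F_mono: "F j \<subseteq> F k" if "j \<le> k" for j k
    using that by (auto simp: F_def)
  define s where "s k = (\<Sum>\<xi>\<in>F k. a \<xi> *\<^sub>C u \<xi>)" for k
  define S where "S k = (\<Sum>\<xi>\<in>F k. f \<xi>)" for k
  have s_mem: "s k \<in> X q" for k
    unfolding s_def by (rule sum_u_mem[OF q(1) F_sub])
  have S_le: "S k \<le> infsum f I" for k
    unfolding S_def by (rule finite_sum_le_infsum[OF f(2) F_fin F_sub f(1)])
  have "incseq S"
    unfolding S_def incseq_def by (intro allI impI sum_mono2 F_fin F_mono f(1))
  then obtain L where "S \<longlonglongrightarrow> L"
    using incseq_convergent S_le by blast
  then have "Cauchy S"
    by (rule LIMSEQ_imp_Cauchy)
  have diff: "N q (s j - s k) \<le> C * (S j - S k) powr (1 / r)" if "k \<le> j" for j k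
  proof -
    have "s j - s k = (\<Sum>\<xi>\<in>F j - F k. a \<xi> *\<^sub>C u \<xi>)" "S j - S k = (\<Sum>\<xi>\<in>F j - F k. f \<xi>)"
      unfolding s_def S_def by (simp_all add: sum_diff F_fin F_mono that)
    then show ?thesis
      using fin[of "F j - F k"] F_fin[of j] F_sub[of j] by auto
  qed
  have "\<exists>M. \<forall>j\<ge>M. \<forall>k\<ge>M. N q (s j - s k) < \<epsilon>" if "\<epsilon> > 0" for \<epsilon> :: real
  proof -
    \<comment> \<open>Chosen so that \<open>d powr (1 / r)\<close> is
      \<open>\<epsilon> / (C + 1)\<close>.\<close>
    define d where "d = (\<epsilon> / (C + 1)) powr r"
    have "d > 0"
      using that C by (simp add: d_def)
    then obtain M where M: "\<And>j k. j \<ge> M \<Longrightarrow> k \<ge> M \<Longrightarrow> \<bar>S j - S k\<bar> < d"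
      using \<open>Cauchy S\<close> unfolding Cauchy_def dist_real_def by meson
    have small: "N q (s j - s k) < \<epsilon>" if "k \<le> j" "M \<le> k" for j k
    proof -
      have "0 \<le> S j - S k" "S j - S k \<le> d"
        using M[of j k] that \<open>incseq S\<close> by (auto simp: incseq_def)
      then have "(S j - S k) powr (1 / r) \<le> d powr (1 / r)"
        using r by (intro powr_mono2) auto
      also have "\<dots> = \<epsilon> / (C + 1)"
        using \<open>\<epsilon> > 0\<close> C r by (simp add: d_def powr_powr)
      finally have "N q (s j - s k) \<le> C * (\<epsilon> / (C + 1))"
        using diff[OF that(1)] C by (meson mult_left_mono order_trans)
      also have "\<dots> < \<epsilon>"
        using \<open>\<epsilon> > 0\<close> C by (simp add: field_simps)
      finally show ?thesis .
    qed
    show ?thesis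
    proof (intro exI[of _ M] allI impI)
      fix j k assume "j \<ge> M" "k \<ge> M"
      then show "N q (s j - s k) < \<epsilon>"
        using small[of k j] small[of j k] N_minus_commute[OF q(1) s_mem s_mem, of j k]
        by (cases "k \<le> j") auto
    qed
  qed
  with q(1) s_mem obtain x where x: "x \<in> X q" and lim: "(\<lambda>k. N q (s k - x)) \<longlonglongrightarrow> 0"
    by (rule N_complete)
  \<comment> \<open>Hoelder's inequality against \<open>v \<eta>\<close> turns convergence in
    \<open>X q\<close> into convergence of coefficients, and the coefficient of \<open>s k\<close>
    equals \<open>a \<eta>\<close> as soon as \<open>\<eta>\<close> has been enumerated.\<close>
  have coeff: "cinner x (v \<eta>) = a \<eta>" if \<eta>: "\<eta> \<in> I" for \<eta>
  proof -
    have "(\<lambda>k. cinner (s k - x) (v \<eta>)) \<longlonglongrightarrow> 0"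
    proof (rule Lim_null_comparison)
      show "\<forall>\<^sub>F k in sequentially. norm (cinner (s k - x) (v \<eta>)) \<le> N q (s k - x) * N p (v \<eta>)"
        using q \<eta> by (intro always_eventually allI hoelder X_diff s_mem x v_mem) auto
      show "(\<lambda>k. N q (s k - x) * N p (v \<eta>)) \<longlonglongrightarrow> 0"
        using lim by (rule tendsto_mult_left_zero)
    qed
    moreover have "\<forall>\<^sub>F k in sequentially. cinner (s k - x) (v \<eta>) = a \<eta> - cinner x (v \<eta>)"
      using eventually_gt_at_top[of "to_nat_on I \<eta>"]
    proof eventually_elim
      case (elim k)
      then have "\<eta> \<in> F k"
        using \<eta> by (simp add: F_def)
      then show ?case
        using cinner_sum_biorth[OF F_fin F_sub \<eta>] by (simp add: cinner_diff_left s_def)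
    qed
    ultimately have "(\<lambda>k. a \<eta> - cinner x (v \<eta>)) \<longlonglongrightarrow> 0"
      by (rule Lim_transform_eventually)
    then show ?thesis
      by (simp add: LIMSEQ_const_iff)
  qed
  have "((\<lambda>\<xi>. a \<xi> *\<^sub>C u \<xi>) has_sum x) I"
    using has_sum_expansion[of x] by (simp add: coeff cong: has_sum_cong)
  then show "(\<lambda>\<xi>. a \<xi> *\<^sub>C u \<xi>) summable_on I" "fourier_inv I u a \<in> X q"
    using x by (auto simp: fourier_inv_def has_sum_imp_summable infsumI)
  from \<open>((\<lambda>\<xi>. a \<xi> *\<^sub>C u \<xi>) has_sum x) I\<close> have inv: "fourier_inv I u a = x"
    by (simp add: fourier_inv_def infsumI)
  \<comment> \<open>The bound for partial sums passes to the limit through the triangle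
    inequality.\<close>
  have "N q x \<le> N q (s k - x) + C * (\<Sum>\<^sub>\<infinity>\<xi>\<in>I. f \<xi>) powr (1 / r)" for k
  proof -
    have "N q x \<le> N q (x - s k) + N q (s k)"
      using N_triangle[OF q(1) X_diff[OF q(1) x s_mem] s_mem, of k k] by simp
    also have "N q (s k) \<le> C * S k powr (1 / r)"
      unfolding s_def S_def by (rule fin[OF F_fin F_sub])
    also have "S k powr (1 / r) \<le> (\<Sum>\<^sub>\<infinity>\<xi>\<in>I. f \<xi>) powr (1 / r)"
      using S_le[of k] r f(1) by (intro powr_mono2) (auto simp: S_def sum_nonneg)
    finally show ?thesis
      using C N_minus_commute[OF q(1) x s_mem, of k] by (simp add: mult_left_mono)
  qed
  moreover have "(\<lambda>k. N q (s k - x) + C * (\<Sum>\<^sub>\<infinity>\<xi>\<in>I. f \<xi>) powr (1 / r))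
      \<longlonglongrightarrow> 0 + C * (\<Sum>\<^sub>\<infinity>\<xi>\<in>I. f \<xi>) powr (1 / r)"
    by (intro tendsto_add lim tendsto_const)
  ultimately show "N q (fourier_inv I u a) \<le> C * (\<Sum>\<^sub>\<infinity>\<xi>\<in>I. f \<xi>) powr (1 / r)"
    unfolding inv add_0 by (intro LIMSEQ_le_const) auto
qed

end

subsection \<open>Interpolation\<close>

text \<open>Passing to \<open>max A B\<close> avoids expanding the power of a sum, and on the unit
  interval lowering an exponent enlarges the power: from \<open>q\<close> to 2 for \<open>B\<close>
  and to 1 for \<open>A\<close>.\<close>

lemma powr_sum_le_if_le_1:
  fixes A B K y q :: real
  assumes "0 \<le> K" "0 \<le> A" "A \<le> 1" "0 \<le> B" "B \<le> 1" "2 \<le> q" "0 \<le> y" "y \<le> K * B + A"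
  shows "y powr q \<le> (K + 1) powr q * (B\<^sup>2 + A)"
proof -
  have "y \<le> (K + 1) * max A B"
    using assms(8) mult_left_mono[OF max.cobounded2[of B A], of K] assms(1)
    by (simp add: distrib_right)
  then have "y powr q \<le> (K + 1) powr q * max A B powr q"
    using powr_mono2[of q y "(K + 1) * max A B"] assms by (simp add: powr_mult)
  moreover have "max A B powr q \<le> B\<^sup>2 + A"
  proof -
    have "A powr q \<le> A powr 1" "B powr q \<le> B powr 2"
      using assms by (intro powr_mono'; simp)+
    then have "A powr q \<le> A" "B powr q \<le> B\<^sup>2"
      using assms by auto
    then show ?thesis
      using assms(2) by (cases "A \<le> B") (auto simp: max_def intro: add_increasing add_increasing2)
  qed
  ultimately show ?thesis
    by (meson mult_left_mono order_trans powr_ge_zero)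
qed

section \<open>Bounds for the K-functional between the exponents 2 and infinity\<close>

context hp_family
begin

lemma K_functional_nonneg: "0 < t \<Longrightarrow> 0 \<le> K_functional (X 2) (N 2) (X \<infinity>) (N \<infinity>) t x"
proof -
  assume "0 < t"
  \<comment> \<open>The trivial decomposition makes the set nonempty, so that its infimum is
    meaningful.\<close>
  have "x = x + 0" "x \<in> X 2" "0 \<in> X \<infinity>"
    using X_2 X_zero[of \<infinity>] by auto
  then have "{N 2 y + t * N \<infinity> z | y z. y \<in> X 2 \<and> z \<in> X \<infinity> \<and> x = y + z} \<noteq> {}"
    by blast
  then show ?thesis
    unfolding K_functional_def
    by (rule cInf_greatest) (use \<open>0 < t\<close> N_nonneg[of \<infinity>] in \<open>auto simp: N_2\<close>)
qed

lemma K_functional_le: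
  assumes "0 < t" "z \<in> X \<infinity>" "x = y + z"
  shows "K_functional (X 2) (N 2) (X \<infinity>) (N \<infinity>) t x \<le> norm y + t * N \<infinity> z"
  unfolding K_functional_def
proof (rule cInf_lower)
  show "norm y + t * N \<infinity> z \<in> {N 2 y + t * N \<infinity> z | y z. y \<in> X 2 \<and> z \<in> X \<infinity> \<and> x = y + z}"
    by (rule CollectI, rule exI[of _ y], rule exI[of _ z]) (use assms X_2 N_2 in simp)
  show "bdd_below {N 2 y + t * N \<infinity> z | y z. y \<in> X 2 \<and> z \<in> X \<infinity> \<and> x = y + z}"
    by (rule bdd_belowI[where m = 0]) (use assms(1) N_nonneg[of \<infinity>] in \<open>auto simp: N_2\<close>)
qed

end

section \<open>Two power integrals\<close>

lemma nn_integral_powr_tail: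
  fixes \<theta> b :: real
  assumes "0 < \<theta>" "0 < b"
  shows "(\<integral>\<^sup>+t. ennreal (t powr (- 2 * \<theta> - 1)) * indicator {b..} t \<partial>lborel)
    = ennreal (b powr (- 2 * \<theta>) / (2 * \<theta>))"
proof (rule nn_integral_has_integral_lebesgue')
  show "((\<lambda>t. t powr (- 2 * \<theta> - 1)) has_integral b powr (- 2 * \<theta>) / (2 * \<theta>)) {b..}"
    using has_integral_powr_to_inf[of "- 2 * \<theta> - 1" b] assms by simp
qed simp

lemma nn_integral_powr_head:
  fixes \<theta> b :: real
  assumes "\<theta> < 1" "0 \<le> b"
  shows "(\<integral>\<^sup>+t. ennreal (t powr (- \<theta>)) * indicator {0..b} t \<partial>lborel)
    = ennreal (b powr (1 - \<theta>) / (1 - \<theta>))"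
proof (rule nn_integral_has_integral_lebesgue')
  show "((\<lambda>t. t powr (- \<theta>)) has_integral b powr (1 - \<theta>) / (1 - \<theta>)) {0..b}"
    using has_integral_powr_from_0[of "- \<theta>" b] assms by (simp add: add.commute)
qed simp

context riesz_hp
begin

text \<open>The vector is split at time \<open>t\<close> according to whether \<open>\<bar>a \<xi>\<bar> / w \<xi>\<close> exceeds \<open>t\<^sup>2\<^sup>/\<^sup>r\<close>, where
  \<open>w \<xi>\<close> is the norm of \<open>u \<xi>\<close> with exponent \<open>\<infinity>\<close>. With this threshold and
  \<open>\<Sum> \<bar>a \<xi>\<bar>\<^sup>r w \<xi>\<^sup>2\<^sup>-\<^sup>r \<le> 1\<close>, the contributions \<open>B\<close> of the \<open>l\<^sup>2\<close> part and \<open>A\<close> of the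
  weighted \<open>l\<^sup>1\<close> part to \<open>t\<^sup>-\<^sup>\<theta> K(t)\<close> are at most 1, so that their \<open>q\<close>-th powers are dominated by
  \<open>B\<^sup>2\<close> and \<open>A\<close>, which are linear in the summands and integrate termwise.\<close>

lemma interp_integral_le:
  fixes r \<theta> q :: real
  assumes r: "1 < r" "r < 2" and \<theta>: "\<theta> = 2 / r - 1" and q: "2 \<le> q"
    and F: "finite F" "F \<subseteq> I" and a0: "\<And>\<xi>. \<xi> \<in> F \<Longrightarrow> a \<xi> \<noteq> 0"
    and sum_le: "(\<Sum>\<xi>\<in>F. cmod (a \<xi>) powr r * N \<infinity> (u \<xi>) powr (2 - r)) \<le> 1"
  shows "interp_integral (X 2) (N 2) (X \<infinity>) (N \<infinity>) \<theta> q (\<Sum>\<xi>\<in>F. a \<xi> *\<^sub>C u \<xi>)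
    \<le> ennreal ((K + 1) powr q * (1 / (2 * \<theta>) + 1 / (1 - \<theta>)))"
proof -
  define w where "w \<xi> = N \<infinity> (u \<xi>)" for \<xi>
  define \<alpha> where "\<alpha> \<xi> = cmod (a \<xi>)" for \<xi>
  define P where "P \<xi> = \<alpha> \<xi> powr r * w \<xi> powr (2 - r)" for \<xi>
  \<comment> \<open>The time at which the threshold \<open>t powr (2 / r)\<close> reaches
    \<open>\<alpha> \<xi> / w \<xi>\<close>: the index \<open>\<xi>\<close> belongs to the
    \<open>l\<^sup>2\<close> part exactly when \<open>b \<xi> \<le> t\<close>.\<close>
  define b where "b \<xi> = (\<alpha> \<xi> / w \<xi>) powr (r / 2)" for \<xi>
  have w: "0 < w \<xi>" if "\<xi> \<in> F" for \<xi>
    using that F N_inf_u_pos by (auto simp: w_def)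
  have \<alpha>: "0 < \<alpha> \<xi>" if "\<xi> \<in> F" for \<xi>
    using a0[OF that] by (simp add: \<alpha>_def)
  have b: "0 < b \<xi>" if "\<xi> \<in> F" for \<xi>
    using w[OF that] \<alpha>[OF that] by (simp add: b_def)
  have P0: "0 \<le> P \<xi>" for \<xi>
    by (simp add: P_def)
  have P1: "sum P F \<le> 1"
    using sum_le by (simp add: P_def \<alpha>_def w_def)
  have \<theta>01: "0 < \<theta>" "\<theta> < 1"
    using r by (auto simp: \<theta> field_simps)
  \<comment> \<open>The exponent relation by which both power integrals, cut off at
    \<open>b \<xi>\<close>, produce the same quantity \<open>P \<xi>\<close>.\<close>
  have r\<theta>: "r * \<theta> = 2 - r"
    using r by (simp add: \<theta> field_simps)
  have b_tail: "(\<alpha> \<xi>)\<^sup>2 * b \<xi> powr (- 2 * \<theta>) = P \<xi>" if "\<xi> \<in> F" for \<xi>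
  proof -
    have "r / 2 * (- 2 * \<theta>) = r - 2"
      using r\<theta> by simp
    then have "b \<xi> powr (- 2 * \<theta>) = (\<alpha> \<xi> / w \<xi>) powr (r - 2)"
      unfolding b_def powr_powr by (rule arg_cong)
    also have "\<dots> = \<alpha> \<xi> powr (r - 2) * w \<xi> powr (2 - r)"
      using w[OF that] \<alpha>[OF that] by (simp add: powr_divide powr_diff)
    finally show ?thesis
      using \<alpha>[OF that] by (simp add: P_def powr_diff)
  qed
  have b_head: "\<alpha> \<xi> * w \<xi> * b \<xi> powr (1 - \<theta>) = P \<xi>" if "\<xi> \<in> F" for \<xi>
  proof -
    have "r / 2 * (1 - \<theta>) = r - 1"
      using r\<theta> by (simp add: field_simps)
    then have "b \<xi> powr (1 - \<theta>) = (\<alpha> \<xi> / w \<xi>) powr (r - 1)"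
      unfolding b_def powr_powr by (rule arg_cong)
    also have "\<dots> = \<alpha> \<xi> powr (r - 1) * w \<xi> powr (1 - r)"
      using w[OF that] \<alpha>[OF that] by (simp add: powr_divide powr_diff)
    finally show ?thesis
      using \<alpha>[OF that] w[OF that] by (simp add: P_def powr_diff power2_eq_square)
  qed
  let ?x = "\<Sum>\<xi>\<in>F. a \<xi> *\<^sub>C u \<xi>"
  let ?K = "\<lambda>t. K_functional (X 2) (N 2) (X \<infinity>) (N \<infinity>) t ?x"
  \<comment> \<open>\<open>?T\<close> and \<open>?H\<close> are the shares of \<open>\<xi>\<close>
    in the squared \<open>l\<^sup>2\<close> contribution and in the weighted
    \<open>l\<^sup>1\<close> contribution, each divided by \<open>t\<close>; the indicators switch
    at \<open>b \<xi>\<close>.\<close>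
  let ?T = "\<lambda>\<xi> t. ennreal ((\<alpha> \<xi>)\<^sup>2) * (ennreal (t powr (- 2 * \<theta> - 1)) * indicator {b \<xi>..} t)"
  let ?H = "\<lambda>\<xi> t. ennreal (\<alpha> \<xi> * w \<xi>) * (ennreal (t powr (- \<theta>)) * indicator {0..b \<xi>} t)"
  let ?D = "(K + 1) powr q"
  have pointwise: "ennreal ((t powr (- \<theta>) * ?K t) powr q / t)
      \<le> ennreal ?D * (\<Sum>\<xi>\<in>F. ?T \<xi> t + ?H \<xi> t)" if t: "0 < t" for t
  proof -
    define F0 where "F0 = {\<xi> \<in> F. b \<xi> \<le> t}"
    define F1 where "F1 = {\<xi> \<in> F. t < b \<xi>}"
    have split: "F = F0 \<union> F1" "F0 \<inter> F1 = {}" and fin: "finite F0" "finite F1"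
      and sub: "F0 \<subseteq> I" "F1 \<subseteq> I" "F0 \<subseteq> F" "F1 \<subseteq> F"
      using F by (auto simp: F0_def F1_def)
    define B where "B = t powr (- \<theta>) * L2_set \<alpha> F0"
    define A where "A = t powr (1 - \<theta>) * (\<Sum>\<xi>\<in>F1. \<alpha> \<xi> * w \<xi>)"
    have t_pow: "(t powr (- \<theta>))\<^sup>2 = t powr (- 2 * \<theta>)"
      unfolding power2_eq_square using t by (simp add: powr_add[symmetric])
    have B2: "B\<^sup>2 = (\<Sum>\<xi>\<in>F0. (\<alpha> \<xi>)\<^sup>2 * t powr (- 2 * \<theta>))"
      by (simp add: B_def L2_set_def power_mult_distrib sum_nonneg t_pow sum_distrib_right
          sum_distrib_left mult.commute)
    \<comment> \<open>\<open>t powr (- 2 * \<theta>)\<close> decreases and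
      \<open>t powr (1 - \<theta>)\<close> increases in \<open>t\<close>, so in both parts the value
      at \<open>b \<xi>\<close> is an upper bound, and there the summand equals
      \<open>P \<xi>\<close>.\<close>
    have "B\<^sup>2 \<le> (\<Sum>\<xi>\<in>F0. P \<xi>)"
      unfolding B2
    proof (rule sum_mono)
      fix \<xi> assume "\<xi> \<in> F0"
      then have \<xi>: "\<xi> \<in> F" "b \<xi> \<le> t"
        by (auto simp: F0_def)
      have "t powr (- 2 * \<theta>) \<le> b \<xi> powr (- 2 * \<theta>)"
        using b[OF \<xi>(1)] \<xi>(2) \<theta>01 by (intro powr_mono2') auto
      then show "(\<alpha> \<xi>)\<^sup>2 * t powr (- 2 * \<theta>) \<le> P \<xi>"
        unfolding b_tail[OF \<xi>(1), symmetric] by (rule mult_left_mono) simp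
    qed
    also have "\<dots> \<le> sum P F"
      by (rule sum_mono2[OF F(1) sub(3)]) (rule P0)
    finally have B2_le: "B\<^sup>2 \<le> 1"
      using P1 by linarith
    have B0: "0 \<le> B"
      by (simp add: B_def L2_set_nonneg)
    have B1: "B \<le> 1"
      using B2_le B0 by (simp add: power2_le_iff_abs_le abs_square_le_1)
    have A_eq: "A = (\<Sum>\<xi>\<in>F1. \<alpha> \<xi> * w \<xi> * t powr (1 - \<theta>))"
      by (simp add: A_def sum_distrib_left mult.commute)
    also have "\<dots> \<le> (\<Sum>\<xi>\<in>F1. P \<xi>)"
    proof (rule sum_mono)
      fix \<xi> assume "\<xi> \<in> F1"
      then have \<xi>: "\<xi> \<in> F" "t < b \<xi>"
        by (auto simp: F1_def)
      have "t powr (1 - \<theta>) \<le> b \<xi> powr (1 - \<theta>)"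
        using t \<xi>(2) \<theta>01 by (intro powr_mono2) auto
      then show "\<alpha> \<xi> * w \<xi> * t powr (1 - \<theta>) \<le> P \<xi>"
        unfolding b_head[OF \<xi>(1), symmetric]
        by (rule mult_left_mono) (use \<alpha>[OF \<xi>(1)] w[OF \<xi>(1)] in simp)
    qed
    also have "\<dots> \<le> sum P F"
      by (rule sum_mono2[OF F(1) sub(4)]) (rule P0)
    finally have A1: "A \<le> 1"
      using P1 by linarith
    have A0: "0 \<le> A"
      unfolding A_def using \<alpha> w sub(4)
      by (intro mult_nonneg_nonneg sum_nonneg) (auto intro!: less_imp_le)
    \<comment> \<open>The sum over \<open>F0\<close> is measured in the Hilbert norm by the
      synthesis bound, the sum over \<open>F1\<close> in the norm with exponent infinity by the
      triangle inequality.\<close>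
    have "?K t \<le> norm (\<Sum>\<xi>\<in>F0. a \<xi> *\<^sub>C u \<xi>) + t * N \<infinity> (\<Sum>\<xi>\<in>F1. a \<xi> *\<^sub>C u \<xi>)"
      by (rule K_functional_le[OF t])
         (use split fin sub in \<open>auto simp: sum.union_disjoint intro!: sum_u_mem\<close>)
    also have "\<dots> \<le> K * L2_set \<alpha> F0 + t * (\<Sum>\<xi>\<in>F1. \<alpha> \<xi> * w \<xi>)"
    proof (intro add_mono mult_left_mono)
      show "norm (\<Sum>\<xi>\<in>F0. a \<xi> *\<^sub>C u \<xi>) \<le> K * L2_set \<alpha> F0"
        using synthesis[OF fin(1) sub(1), of a] by (simp add: \<alpha>_def[abs_def])
      have "N \<infinity> (\<Sum>\<xi>\<in>F1. a \<xi> *\<^sub>C u \<xi>) \<le> (\<Sum>\<xi>\<in>F1. N \<infinity> (a \<xi> *\<^sub>C u \<xi>))"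
        using sub(2) by (intro N_sum fin X_scaleC u_mem) auto
      also have "\<dots> = (\<Sum>\<xi>\<in>F1. \<alpha> \<xi> * w \<xi>)"
        using sub(2) by (intro sum.cong) (auto simp: N_scaleC u_mem \<alpha>_def w_def)
      finally show "N \<infinity> (\<Sum>\<xi>\<in>F1. a \<xi> *\<^sub>C u \<xi>) \<le> (\<Sum>\<xi>\<in>F1. \<alpha> \<xi> * w \<xi>)" .
    qed (use t in simp)
    finally have "t powr (- \<theta>) * ?K t
        \<le> t powr (- \<theta>) * (K * L2_set \<alpha> F0 + t * (\<Sum>\<xi>\<in>F1. \<alpha> \<xi> * w \<xi>))"
      by (rule mult_left_mono) simp
    also have "\<dots> = K * B + (t powr (- \<theta>) * t) * (\<Sum>\<xi>\<in>F1. \<alpha> \<xi> * w \<xi>)"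
      by (simp add: B_def algebra_simps)
    also have "t powr (- \<theta>) * t = t powr (1 - \<theta>)"
      using t by (simp add: powr_diff powr_minus divide_inverse mult.commute)
    also have "\<dots> * (\<Sum>\<xi>\<in>F1. \<alpha> \<xi> * w \<xi>) = A"
      by (simp add: A_def)
    finally have "(t powr (- \<theta>) * ?K t) powr q \<le> ?D * (B\<^sup>2 + A)"
      by (intro powr_sum_le_if_le_1 K_nonneg A0 A1 B0 B1 q mult_nonneg_nonneg
          K_functional_nonneg t powr_ge_zero)
    then have "(t powr (- \<theta>) * ?K t) powr q / t \<le> ?D * (B\<^sup>2 + A) / t"
      using t by (simp add: divide_right_mono)
    also have "\<dots> = ?D * ((\<Sum>\<xi>\<in>F0. (\<alpha> \<xi>)\<^sup>2 * t powr (- 2 * \<theta> - 1))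
        + (\<Sum>\<xi>\<in>F1. \<alpha> \<xi> * w \<xi> * t powr (- \<theta>)))"
    proof -
      have "t powr (- 2 * \<theta> - 1) = t powr (- 2 * \<theta>) / t"
        using t by (simp add: powr_diff)
      moreover have "t powr (- \<theta>) = t powr (1 - \<theta>) / t"
        using powr_diff[of t "1 - \<theta>" 1] t by simp
      ultimately show ?thesis
        unfolding B2 A_eq by (simp flip: sum_divide_distrib add_divide_distrib)
    qed
    also have "ennreal \<dots> = ennreal ?D * ((\<Sum>\<xi>\<in>F0. ennreal ((\<alpha> \<xi>)\<^sup>2 * t powr (- 2 * \<theta> - 1)))
        + (\<Sum>\<xi>\<in>F1. ennreal (\<alpha> \<xi> * w \<xi> * t powr (- \<theta>))))"
    proof -
      have "0 \<le> \<alpha> \<xi> * w \<xi> * t powr (- \<theta>)" if "\<xi> \<in> F1" for \<xi>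
        using that sub(4) \<alpha>[of \<xi>] w[of \<xi>] by auto
      then show ?thesis
        by (simp add: ennreal_mult[of "(K + 1) powr q"] ennreal_plus sum_nonneg sum_ennreal)
    qed
    \<comment> \<open>On \<open>F0\<close> and \<open>F1\<close> the indicators equal 1. Enlarging
      both to \<open>F\<close> makes the index set independent of \<open>t\<close>, so that sum and
      integral can be exchanged.\<close>
    also have "(\<Sum>\<xi>\<in>F0. ennreal ((\<alpha> \<xi>)\<^sup>2 * t powr (- 2 * \<theta> - 1))) = (\<Sum>\<xi>\<in>F0. ?T \<xi> t)"
      by (rule sum.cong) (auto simp: F0_def ennreal_mult)
    also have "\<dots> \<le> (\<Sum>\<xi>\<in>F. ?T \<xi> t)"
      by (rule sum_mono2[OF F(1) sub(3)]) simp
    also have "(\<Sum>\<xi>\<in>F1. ennreal (\<alpha> \<xi> * w \<xi> * t powr (- \<theta>))) = (\<Sum>\<xi>\<in>F1. ?H \<xi> t)"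
      using t by (intro sum.cong) (auto simp: F1_def ennreal_mult'')
    also have "\<dots> \<le> (\<Sum>\<xi>\<in>F. ?H \<xi> t)"
      by (rule sum_mono2[OF F(1) sub(4)]) simp
    finally show ?thesis
      by (simp add: sum.distrib ennreal_leI mult_left_mono add_mono)
  qed
  have "interp_integral (X 2) (N 2) (X \<infinity>) (N \<infinity>) \<theta> q ?x
      \<le> (\<integral>\<^sup>+t. ennreal ?D * (\<Sum>\<xi>\<in>F. ?T \<xi> t + ?H \<xi> t) \<partial>lborel)"
    unfolding interp_integral_def
  proof (rule nn_integral_mono)
    fix t :: real
    show "ennreal ((t powr (- \<theta>) * ?K t) powr q / t) * indicator {0<..} t
        \<le> ennreal ?D * (\<Sum>\<xi>\<in>F. ?T \<xi> t + ?H \<xi> t)"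
    proof (cases "0 < t")
      case True
      then have "indicator {0<..} t = (1::ennreal)"
        by simp
      with pointwise[OF True] show ?thesis
        by (simp only: mult_1_right)
    next
      case False
      then have "indicator {0<..} t = (0::ennreal)"
        by simp
      then show ?thesis
        by (simp only: mult_zero_right zero_le)
    qed
  qed
  also have "\<dots> = ennreal ?D * (\<Sum>\<xi>\<in>F. (\<integral>\<^sup>+t. ?T \<xi> t \<partial>lborel) + (\<integral>\<^sup>+t. ?H \<xi> t \<partial>lborel))"
    by (simp add: nn_integral_cmult nn_integral_sum nn_integral_add)
  also have "(\<Sum>\<xi>\<in>F. (\<integral>\<^sup>+t. ?T \<xi> t \<partial>lborel) + (\<integral>\<^sup>+t. ?H \<xi> t \<partial>lborel))
      = (\<Sum>\<xi>\<in>F. ennreal (P \<xi> * (1 / (2 * \<theta>) + 1 / (1 - \<theta>))))"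
  proof (rule sum.cong[OF refl])
    fix \<xi> assume \<xi>: "\<xi> \<in> F"
    have "(\<integral>\<^sup>+t. ?T \<xi> t \<partial>lborel) = ennreal ((\<alpha> \<xi>)\<^sup>2) * ennreal (b \<xi> powr (- 2 * \<theta>) / (2 * \<theta>))"
      using nn_integral_powr_tail[OF \<theta>01(1) b[OF \<xi>]] by (simp add: nn_integral_cmult)
    also have "\<dots> = ennreal (P \<xi> / (2 * \<theta>))"
      using \<theta>01 by (simp add: b_tail[OF \<xi>, symmetric] ennreal_mult[symmetric])
    finally have T: "(\<integral>\<^sup>+t. ?T \<xi> t \<partial>lborel) = ennreal (P \<xi> / (2 * \<theta>))" .
    have "(\<integral>\<^sup>+t. ?H \<xi> t \<partial>lborel) = ennreal (\<alpha> \<xi> * w \<xi>) * ennreal (b \<xi> powr (1 - \<theta>) / (1 - \<theta>))"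
      using nn_integral_powr_head[OF \<theta>01(2) less_imp_le[OF b[OF \<xi>]]] by (simp add: nn_integral_cmult)
    also have "\<dots> = ennreal (P \<xi> / (1 - \<theta>))"
      using \<theta>01 \<alpha>[OF \<xi>] w[OF \<xi>] by (simp add: b_head[OF \<xi>, symmetric] ennreal_mult[symmetric])
    finally show "(\<integral>\<^sup>+t. ?T \<xi> t \<partial>lborel) + (\<integral>\<^sup>+t. ?H \<xi> t \<partial>lborel)
        = ennreal (P \<xi> * (1 / (2 * \<theta>) + 1 / (1 - \<theta>)))"
      unfolding T using P0[of \<xi>] \<theta>01 by (simp add: ennreal_plus[symmetric] distrib_left del: ennreal_plus)
  qed
  also have "\<dots> = ennreal (sum P F * (1 / (2 * \<theta>) + 1 / (1 - \<theta>)))"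
    using P0 \<theta>01 by (subst sum_ennreal) (auto simp: sum_distrib_right)
  also have "\<dots> \<le> ennreal (1 * (1 / (2 * \<theta>) + 1 / (1 - \<theta>)))"
    using P1 \<theta>01 by (intro ennreal_leI mult_right_mono) auto
  finally show ?thesis
    by (simp add: ennreal_mult'[symmetric] mult_left_mono)
qed

text \<open>The interpolation norm is controlled for normalized coefficients and is equivalent to
  \<open>N (ennreal q)\<close>; homogeneity removes the normalization.\<close>

lemma finite_synthesis_interpolated:
  fixes r q :: real
  assumes r: "1 < r" "r < 2" and q: "1 / r + 1 / q = 1"
  obtains C where "1 \<le> C" "\<And>F a. finite F \<Longrightarrow> F \<subseteq> I \<Longrightarrow>
    N (ennreal q) (\<Sum>\<xi>\<in>F. a \<xi> *\<^sub>C u \<xi>)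
      \<le> C * (\<Sum>\<xi>\<in>F. cmod (a \<xi>) powr r * N \<infinity> (u \<xi>) powr (2 - r)) powr (1 / r)"
proof -
  \<comment> \<open>The parameter for which \<open>(1 - \<theta>) / 2\<close> equals
    \<open>1 / q\<close>.\<close>
  define \<theta> where "\<theta> = 2 / r - 1"
  have \<theta>: "0 < \<theta>" "\<theta> < 1"
    using r by (auto simp: \<theta>_def field_simps)
  have q_inv: "1 / q = (1 - \<theta>) / 2"
    using q by (simp add: \<theta>_def field_simps)
  have "0 < 1 / q" "1 / q < 1 / 2"
    unfolding q_inv using \<theta> by auto
  then have q2: "2 \<le> q"
    by (simp add: field_simps zero_less_divide_iff)
  then have q1: "1 \<le> ennreal q"
    by (simp flip: ennreal_1)
  define E where "E = (K + 1) powr q * (1 / (2 * \<theta>) + 1 / (1 - \<theta>))"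
  have E0: "0 \<le> E"
    using \<theta> by (simp add: E_def)
  obtain D where D: "0 < D" and N_le: "\<And>x. x \<in> X (ennreal q) \<Longrightarrow>
      N (ennreal q) x \<le> D * interp_norm (X 2) (N 2) (X \<infinity>) (N \<infinity>) \<theta> q x"
    using interp_2_inf[OF \<theta> q_inv] unfolding same_space_def by auto
  define C where "C = max 1 (D * E powr (1 / q))"
  define P where "P a \<xi> = cmod (a \<xi>) powr r * N \<infinity> (u \<xi>) powr (2 - r)" for a \<xi>
  have normalized: "N (ennreal q) (\<Sum>\<xi>\<in>F. a \<xi> *\<^sub>C u \<xi>) \<le> C"
    if F: "finite F" "F \<subseteq> I" and a: "\<And>\<xi>. \<xi> \<in> F \<Longrightarrow> a \<xi> \<noteq> 0" "sum (P a) F \<le> 1" for F a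
  proof -
    let ?x = "\<Sum>\<xi>\<in>F. a \<xi> *\<^sub>C u \<xi>"
    have "interp_integral (X 2) (N 2) (X \<infinity>) (N \<infinity>) \<theta> q ?x \<le> ennreal E"
      unfolding E_def
      by (rule interp_integral_le[OF r \<theta>_def q2 F]) (use a in \<open>auto simp: P_def\<close>)
    then have "interp_norm (X 2) (N 2) (X \<infinity>) (N \<infinity>) \<theta> q ?x \<le> E powr (1 / q)"
      unfolding interp_norm_def using E0 q2 by (intro powr_mono2 enn2real_leI) auto
    then have "N (ennreal q) ?x \<le> D * E powr (1 / q)"
      using N_le[OF sum_u_mem[OF q1 F(2)], of a] D by (meson less_imp_le mult_left_mono order_trans)
    then show ?thesis
      by (simp add: C_def)
  qed
  have "N (ennreal q) (\<Sum>\<xi>\<in>F. a \<xi> *\<^sub>C u \<xi>) \<le> C * sum (P a) F powr (1 / r)"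
    if F: "finite F" "F \<subseteq> I" for F a
  proof -
    \<comment> \<open>Zero coefficients are dropped because the splitting times in
      \<open>interp_integral_le\<close> must be positive.\<close>
    define G where "G = {\<xi> \<in> F. a \<xi> \<noteq> 0}"
    have G: "finite G" "G \<subseteq> I"
      using F by (auto simp: G_def)
    have sum_G: "(\<Sum>\<xi>\<in>F. a \<xi> *\<^sub>C u \<xi>) = (\<Sum>\<xi>\<in>G. a \<xi> *\<^sub>C u \<xi>)"
      using F by (intro sum.mono_neutral_right) (auto simp: G_def)
    have sum_P: "sum (P a) F = sum (P a) G"
      using F by (intro sum.mono_neutral_right) (auto simp: G_def P_def)
    show ?thesis
    proof (cases "G = {}")
      case True
      then show ?thesis
        using N_eq_0_iff[OF q1 X_zero[OF q1]] by (simp add: sum_G sum_P)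
    next
      case False
      define S where "S = sum (P a) G"
      have "0 < S"
        unfolding S_def using G False N_inf_u_pos
        by (intro sum_pos) (auto simp: P_def G_def subset_iff less_imp_neq[symmetric])
      \<comment> \<open>\<open>sum (P a) G\<close> is homogeneous of degree \<open>r\<close> in
        \<open>a\<close>, so division by \<open>m\<close> normalizes it to 1.\<close>
      define m where "m = S powr (1 / r)"
      have m: "0 < m" "m powr r = S"
        using \<open>0 < S\<close> r by (auto simp: m_def powr_powr)
      define a' where "a' \<xi> = a \<xi> / complex_of_real m" for \<xi>
      have "P a' \<xi> = P a \<xi> / S" for \<xi>
        using m by (simp add: P_def a'_def norm_divide powr_divide)
      then have "sum (P a') G = 1"
        using \<open>0 < S\<close> by (simp add: S_def sum_divide_distrib[symmetric])
      then have le: "N (ennreal q) (\<Sum>\<xi>\<in>G. a' \<xi> *\<^sub>C u \<xi>) \<le> C"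
        using m(1) by (intro normalized G) (simp_all, simp add: a'_def G_def)
      have "(\<Sum>\<xi>\<in>G. a \<xi> *\<^sub>C u \<xi>) = complex_of_real m *\<^sub>C (\<Sum>\<xi>\<in>G. a' \<xi> *\<^sub>C u \<xi>)"
        using m(1) by (simp add: scaleC_sum_right scaleC_scaleC a'_def)
      then have "N (ennreal q) (\<Sum>\<xi>\<in>G. a \<xi> *\<^sub>C u \<xi>)
          = m * N (ennreal q) (\<Sum>\<xi>\<in>G. a' \<xi> *\<^sub>C u \<xi>)"
        using m(1) by (simp add: N_scaleC[OF q1 sum_u_mem[OF q1 G(2)]])
      also have "\<dots> \<le> m * C"
        using le m(1) by (intro mult_left_mono) auto
      finally show ?thesis
        by (simp add: sum_G sum_P m_def S_def mult.commute)
    qed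
  qed
  then show thesis
    by (intro that[of C]) (auto simp: C_def P_def)
qed

subsection \<open>Duality\<close>

text \<open>Testing \<open>f\<close> against a suitable finite sum gives
  \<open>S \<le> C * N p f * S powr (1 / r)\<close> for the left side \<open>S\<close>; cancelling
  leaves \<open>S powr (1 / s)\<close>.\<close>

lemma coeff_powr_sum_le:
  fixes r s C :: real
  assumes r: "1 < r" and s: "1 / r + 1 / s = 1"
    and q: "1 \<le> q" "1 \<le> p" "1 / p + 1 / q = 1" and f: "f \<in> X p" and C: "0 \<le> C"
    and F: "finite F" "F \<subseteq> I"
    and fin: "\<And>a. N q (\<Sum>\<xi>\<in>F. a \<xi> *\<^sub>C u \<xi>)
      \<le> C * (\<Sum>\<xi>\<in>F. cmod (a \<xi>) powr r * N \<infinity> (u \<xi>) powr (2 - r)) powr (1 / r)"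
  shows "(\<Sum>\<xi>\<in>F. cmod (cinner f (u \<xi>)) powr s * N \<infinity> (u \<xi>) powr (2 - s))
    \<le> (C * N p f) powr s"
proof -
  define c where "c \<xi> = cinner f (u \<xi>)" for \<xi>
  define w where "w \<xi> = N \<infinity> (u \<xi>)" for \<xi>
  define Q where "Q \<xi> = cmod (c \<xi>) powr s * w \<xi> powr (2 - s)" for \<xi>
  \<comment> \<open>The extremal sequence of Hoelder's inequality: since
    \<open>(s - 1) * r = s\<close>, both its pairing with \<open>c\<close> and its own weighted
    \<open>r\<close>-th powers give \<open>Q\<close>.\<close>
  define g where "g \<xi> = c \<xi> * complex_of_real (cmod (c \<xi>) powr (s - 2) * w \<xi> powr (2 - s))" for \<xi>
  define S where "S = sum Q F"
  have s_inv: "1 / s = 1 - 1 / r"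
    using s by simp
  have "0 < 1 / s" "1 / s < 1"
    unfolding s_inv using r by auto
  then have s1: "1 < s"
    by (simp add: zero_less_divide_iff)
  then have rs: "(s - 1) * r = s"
    using s r by (simp add: field_simps)
  have S0: "0 \<le> S"
    by (simp add: S_def Q_def sum_nonneg)
  have w: "0 < w \<xi>" if "\<xi> \<in> F" for \<xi>
    using that F N_inf_u_pos by (auto simp: w_def)
  have g_pair: "cnj (g \<xi>) * c \<xi> = complex_of_real (Q \<xi>)" for \<xi>
  proof -
    have "cnj (g \<xi>) * c \<xi> = (c \<xi> * cnj (c \<xi>)) *
        complex_of_real (cmod (c \<xi>) powr (s - 2) * w \<xi> powr (2 - s))"
      by (simp add: g_def)
    also have "c \<xi> * cnj (c \<xi>) = complex_of_real ((cmod (c \<xi>))\<^sup>2)"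
      by (rule complex_norm_square[symmetric])
    also have "\<dots> * complex_of_real (cmod (c \<xi>) powr (s - 2) * w \<xi> powr (2 - s))
        = complex_of_real (((cmod (c \<xi>))\<^sup>2 * cmod (c \<xi>) powr (s - 2)) * w \<xi> powr (2 - s))"
      by simp
    also have "(cmod (c \<xi>))\<^sup>2 * cmod (c \<xi>) powr (s - 2) = cmod (c \<xi>) powr s"
      by (cases "c \<xi> = 0") (auto simp: powr_diff)
    finally show ?thesis
      by (simp add: Q_def)
  qed
  have g_pow: "cmod (g \<xi>) powr r * w \<xi> powr (2 - r) = Q \<xi>" if "\<xi> \<in> F" for \<xi>
  proof (cases "c \<xi> = 0")
    case False
    have "cmod (g \<xi>) = cmod (c \<xi>) powr (s - 1) * w \<xi> powr (2 - s)"
      using False powr_add[of "cmod (c \<xi>)" 1 "s - 2"] by (simp add: g_def norm_mult)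
    then have "cmod (g \<xi>) powr r = cmod (c \<xi>) powr s * w \<xi> powr ((2 - s) * r)"
      by (simp add: powr_mult powr_powr rs)
    moreover have "w \<xi> powr ((2 - s) * r) * w \<xi> powr (2 - r) = w \<xi> powr (2 - s)"
    proof -
      have "(2 - s) * r + (2 - r) = 2 - s"
        using rs by (simp add: algebra_simps)
      then show ?thesis
        unfolding powr_add[symmetric] by (rule arg_cong)
    qed
    ultimately show ?thesis
      by (simp add: Q_def)
  qed (simp add: g_def Q_def)
  have "cinner f (\<Sum>\<xi>\<in>F. g \<xi> *\<^sub>C u \<xi>) = complex_of_real S"
    using g_pair by (simp add: cinner_sum_right cinner_scaleC_right S_def flip: c_def)
  then have "S = cmod (cinner f (\<Sum>\<xi>\<in>F. g \<xi> *\<^sub>C u \<xi>))"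
    using S0 by simp
  also have "\<dots> \<le> N p f * N q (\<Sum>\<xi>\<in>F. g \<xi> *\<^sub>C u \<xi>)"
    by (rule hoelder[OF q(2,1,3) f sum_u_mem[OF q(1) F(2)]])
  also have "\<dots> \<le> N p f * (C * S powr (1 / r))"
  proof (rule mult_left_mono[OF _ N_nonneg[OF q(2) f]])
    have "(\<Sum>\<xi>\<in>F. cmod (g \<xi>) powr r * N \<infinity> (u \<xi>) powr (2 - r)) = S"
      unfolding S_def w_def[symmetric] by (rule sum.cong) (simp_all add: g_pow)
    then show "N q (\<Sum>\<xi>\<in>F. g \<xi> *\<^sub>C u \<xi>) \<le> C * S powr (1 / r)"
      using fin[of g] by simp
  qed
  finally have S_le: "S \<le> C * N p f * S powr (1 / r)"
    by (simp add: mult_ac)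
  \<comment> \<open>Cancelling \<open>S powr (1 / r)\<close> needs \<open>S\<close> positive; for
    \<open>S = 0\<close> the bound is trivial.\<close>
  have "S \<le> (C * N p f) powr s"
  proof (cases "S = 0")
    case False
    with S0 have "0 < S" by simp
    have "S powr (1 / s) * S powr (1 / r) = S"
      using \<open>0 < S\<close> s by (simp add: add.commute flip: powr_add)
    with S_le have "S powr (1 / s) * S powr (1 / r) \<le> C * N p f * S powr (1 / r)"
      by simp
    then have "S powr (1 / s) \<le> C * N p f"
      by (rule mult_right_le_imp_le) (use \<open>0 < S\<close> in simp)
    then have "(S powr (1 / s)) powr s \<le> (C * N p f) powr s"
      using s1 by (intro powr_mono2) auto
    then show ?thesis
      using \<open>0 < S\<close> s1 by (simp add: powr_powr)
  qed simp
  then show ?thesis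
    by (simp add: S_def Q_def c_def w_def)
qed

subsection \<open>The Hausdorff--Young inequality for one Riesz basis\<close>

text \<open>Brings the two endpoints and the interpolated range into one form, with \<open>r\<close>
  the real number behind the extended exponent \<open>p\<close>.\<close>

lemma finite_synthesis:
  assumes "p = 1 \<and> p' = \<infinity> \<and> r = 1 \<or>
    (\<exists>s. p = ennreal r \<and> p' = ennreal s \<and> 1 < r \<and> r \<le> 2 \<and> 2 \<le> s \<and> 1 / r + 1 / s = 1)"
  obtains C where "1 \<le> C" "\<And>F a. finite F \<Longrightarrow> F \<subseteq> I \<Longrightarrow>
    N p' (\<Sum>\<xi>\<in>F. a \<xi> *\<^sub>C u \<xi>)
      \<le> C * (\<Sum>\<xi>\<in>F. cmod (a \<xi>) powr r * N \<infinity> (u \<xi>) powr (2 - r)) powr (1 / r)"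
proof -
  consider "p' = \<infinity>" "r = 1" | "p' = 2" "r = 2" |
    s where "p' = ennreal s" "1 < r" "r < 2" "1 / r + 1 / s = 1"
  proof (cases "r = 2")
    case True
    with assms obtain s where s: "p' = ennreal s" "2 \<le> s" "1 / 2 + 1 / s = 1"
      by auto
    then have "s = 2"
      by (simp add: field_simps)
    with s(1) have "p' = 2"
      by simp
    then show ?thesis
      using True that(2) by simp
  next
    case False
    from assms show ?thesis
    proof (elim disjE exE conjE)
      fix s
      assume "p' = ennreal s" "1 < r" "r \<le> 2" "1 / r + 1 / s = 1"
      with False show ?thesis
        by (intro that(3)) auto
    qed (rule that(1))
  qed
  then show thesis
  proof cases
    case 1
    have "N p' (\<Sum>\<xi>\<in>F. a \<xi> *\<^sub>C u \<xi>)
        \<le> 1 * (\<Sum>\<xi>\<in>F. cmod (a \<xi>) powr r * N \<infinity> (u \<xi>) powr (2 - r)) powr (1 / r)"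
      if F: "finite F" "F \<subseteq> I" for F a
    proof -
      have "N \<infinity> (\<Sum>\<xi>\<in>F. a \<xi> *\<^sub>C u \<xi>) \<le> (\<Sum>\<xi>\<in>F. N \<infinity> (a \<xi> *\<^sub>C u \<xi>))"
        using F by (intro N_sum X_scaleC u_mem) auto
      also have "\<dots> = (\<Sum>\<xi>\<in>F. cmod (a \<xi>) powr 1 * N \<infinity> (u \<xi>) powr (2 - 1))"
        using F N_inf_u_pos by (intro sum.cong) (auto simp: N_scaleC u_mem subset_iff less_imp_le)
      finally show ?thesis
        using 1 by (simp add: sum_nonneg)
    qed
    then show thesis
      by (rule that[rotated]) simp_all
  next
    case 2
    have "N p' (\<Sum>\<xi>\<in>F. a \<xi> *\<^sub>C u \<xi>)
        \<le> max 1 K * (\<Sum>\<xi>\<in>F. cmod (a \<xi>) powr r * N \<infinity> (u \<xi>) powr (2 - r)) powr (1 / r)"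
      if F: "finite F" "F \<subseteq> I" for F a
    proof -
      \<comment> \<open>\<open>0 powr 0\<close> is 0, so the weight with exponent 0 equals 1 only
        because the norm is nonzero.\<close>
      have w: "N \<infinity> (u \<xi>) \<noteq> 0" if "\<xi> \<in> F" for \<xi>
        using that F N_inf_u_pos[of \<xi>] by auto
      have "(\<Sum>\<xi>\<in>F. cmod (a \<xi>) powr r * N \<infinity> (u \<xi>) powr (2 - r)) = (\<Sum>\<xi>\<in>F. (cmod (a \<xi>))\<^sup>2)"
        using 2 w by (intro sum.cong) auto
      then have "(\<Sum>\<xi>\<in>F. cmod (a \<xi>) powr r * N \<infinity> (u \<xi>) powr (2 - r)) powr (1 / r)
          = L2_set (\<lambda>\<xi>. cmod (a \<xi>)) F"
        using 2 by (simp add: L2_set_def powr_half_sqrt sum_nonneg)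
      moreover have "norm (\<Sum>\<xi>\<in>F. a \<xi> *\<^sub>C u \<xi>) \<le> K * L2_set (\<lambda>\<xi>. cmod (a \<xi>)) F"
        by (rule synthesis[OF F])
      moreover have "K * L2_set (\<lambda>\<xi>. cmod (a \<xi>)) F \<le> max 1 K * L2_set (\<lambda>\<xi>. cmod (a \<xi>)) F"
        by (rule mult_right_mono) (simp_all add: L2_set_nonneg)
      ultimately show ?thesis
        using 2 by (simp add: N_2)
    qed
    then show thesis
      by (rule that[rotated]) simp_all
  next
    case (3 s)
    show thesis
      by (rule finite_synthesis_interpolated[OF 3(2,3,4)]) (rule that, simp_all add: 3(1))
  qed
qed

text \<open>Synthesis and analysis by the same system \<open>u\<close> are adjoint, hence treated
  together. The weights of \<open>l\<^sup>p(U)\<close> and of the dual \<open>l\<^sup>p(V)\<close>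
  space with exponent \<open>p'\<close> are both powers of the norms of \<open>u\<close>; exchanging
  \<open>u\<close> and \<open>v\<close> yields the other two bounds.\<close>

proposition hausdorff_young:
  assumes p: "1 \<le> p" "1 \<le> p'" "1 / p + 1 / p' = 1"
    and exponents: "p = 1 \<and> p' = \<infinity> \<and> r = 1 \<or>
      (\<exists>s. p = ennreal r \<and> p' = ennreal s \<and> 1 < r \<and> r \<le> 2 \<and> 2 \<le> s \<and> 1 / r + 1 / s = 1)"
  obtains C where "1 \<le> C"
    and "\<And>a. a \<in> lp_space I (N \<infinity>) u v p \<Longrightarrow> (\<lambda>\<xi>. a \<xi> *\<^sub>C u \<xi>) summable_on I \<and>
      fourier_inv I u a \<in> X p' \<and>
      N p' (fourier_inv I u a) \<le> C * lp_norm I (N \<infinity>) u v p a"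
    and "\<And>f. f \<in> X p \<Longrightarrow> fourier u f \<in> lp_space I (N \<infinity>) v u p' \<and>
      lp_norm I (N \<infinity>) v u p' (fourier u f) \<le> C * N p f"
proof -
  obtain C where C: "1 \<le> C" and fin: "\<And>F a. finite F \<Longrightarrow> F \<subseteq> I \<Longrightarrow>
      N p' (\<Sum>\<xi>\<in>F. a \<xi> *\<^sub>C u \<xi>)
        \<le> C * (\<Sum>\<xi>\<in>F. cmod (a \<xi>) powr r * N \<infinity> (u \<xi>) powr (2 - r)) powr (1 / r)"
    by (rule finite_synthesis[OF exponents]) (rule that)
  have r: "0 < r" "enn2real p = r" "p \<noteq> \<infinity>" "p \<le> 2"
    using exponents by (auto simp: ennreal_le_iff simp flip: ennreal_numeral)
  have p_conj: "1 / p' + 1 / p = 1"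
    using p(3) by (simp add: add.commute)
  have syn: "(\<lambda>\<xi>. a \<xi> *\<^sub>C u \<xi>) summable_on I \<and> fourier_inv I u a \<in> X p' \<and>
      N p' (fourier_inv I u a) \<le> C * lp_norm I (N \<infinity>) u v p a"
    if a: "a \<in> lp_space I (N \<infinity>) u v p" for a
  proof -
    let ?f = "lp_term (N \<infinity>) u v p a"
    have f: "?f \<xi> = cmod (a \<xi>) powr r * N \<infinity> (u \<xi>) powr (2 - r)" for \<xi>
      using r by (simp add: lp_term_def)
    have summ: "?f summable_on I"
      using a r by (simp add: lp_space_def)
    have f0: "0 \<le> ?f \<xi>" for \<xi>
      unfolding f by simp
    have fin': "N p' (\<Sum>\<xi>\<in>F. a \<xi> *\<^sub>C u \<xi>) \<le> C * (\<Sum>\<xi>\<in>F. ?f \<xi>) powr (1 / r)"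
      if "finite F" "F \<subseteq> I" for F
      unfolding f by (rule fin[OF that])
    have "lp_norm I (N \<infinity>) u v p a = (\<Sum>\<^sub>\<infinity>\<xi>\<in>I. ?f \<xi>) powr (1 / r)"
      using r by (simp add: lp_norm_def)
    moreover have "0 \<le> C"
      using C by simp
    ultimately show ?thesis
      using series_in_hp[OF p(2,1) p_conj r(1) _ fin' f0 summ] by simp
  qed
  have ana: "fourier u f \<in> lp_space I (N \<infinity>) v u p' \<and>
      lp_norm I (N \<infinity>) v u p' (fourier u f) \<le> C * N p f" if f: "f \<in> X p" for f
  proof (cases "p' = \<infinity>")
    case True
    let ?t = "lp_term (N \<infinity>) v u p' (fourier u f)"
    have CN: "0 \<le> C * N p f"
      using C N_nonneg[OF p(1) f] by simp
    have le: "?t \<xi> \<le> C * N p f" if "\<xi> \<in> I" for \<xi>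
    proof -
      \<comment> \<open>At \<open>p' = \<infinity>\<close> each coefficient is bounded directly by
        Hoelder's inequality, whose second factor is the weight.\<close>
      have "cmod (cinner f (u \<xi>)) \<le> N p f * N p' (u \<xi>)"
        by (rule hoelder[OF p f u_mem[OF p(2) that]])
      then have "?t \<xi> \<le> N p f"
        using N_inf_u_pos[OF that] True by (simp add: lp_term_def fourier_def divide_le_eq)
      also have "\<dots> \<le> C * N p f"
        using C N_nonneg[OF p(1) f] mult_right_mono[of 1 C "N p f"] by simp
      finally show ?thesis .
    qed
    have "bdd_above (?t ` I)"
      using le by (intro bdd_aboveI[where M = "C * N p f"]) auto
    moreover have "Sup (insert 0 (?t ` I)) \<le> C * N p f"
      using le CN by (intro cSup_least) auto
    ultimately show ?thesis
      using True by (simp add: lp_space_def lp_norm_def)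
  next
    case False
    then obtain s where s: "p' = ennreal s" "1 < r" "2 \<le> s" "1 / r + 1 / s = 1"
      using exponents by auto
    have s_simps: "enn2real p' = s" "p' \<le> 2 \<longleftrightarrow> s = 2"
      using s by (auto simp: ennreal_le_iff simp flip: ennreal_numeral)
    let ?t = "lp_term (N \<infinity>) v u p' (fourier u f)"
    \<comment> \<open>At \<open>s = 2\<close> the definition selects the weight from
      \<open>v\<close> instead of \<open>u\<close>; both norms are positive and the exponent is 0,
      so either weight is 1.\<close>
    have t: "?t \<xi> = cmod (cinner f (u \<xi>)) powr s * N \<infinity> (u \<xi>) powr (2 - s)" if "\<xi> \<in> I" for \<xi>
      using N_inf_u_pos[OF that] N_inf_v_pos[OF that] False
      by (auto simp: lp_term_def fourier_def s_simps)
    have t0: "0 \<le> ?t \<xi>" if "\<xi> \<in> I" for \<xi>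
      unfolding t[OF that] by simp
    have le: "sum ?t F \<le> (C * N p f) powr s" if F: "finite F" "F \<subseteq> I" for F
    proof -
      have "sum ?t F = (\<Sum>\<xi>\<in>F. cmod (cinner f (u \<xi>)) powr s * N \<infinity> (u \<xi>) powr (2 - s))"
        by (rule sum.cong) (use F t in auto)
      also have "\<dots> \<le> (C * N p f) powr s"
        using C by (intro coeff_powr_sum_le[OF s(2,4) p(2,1,3) f _ F fin[OF F]]) auto
      finally show ?thesis .
    qed
    \<comment> \<open>The bounds on finite sums are uniform, which gives membership in the sequence
      space along with the norm estimate.\<close>
    have summ: "?t summable_on I"
    proof (rule nonneg_bdd_above_summable_on)
      show "bdd_above (sum ?t ` {F. F \<subseteq> I \<and> finite F})"
        using le by (intro bdd_aboveI[where M = "(C * N p f) powr s"]) auto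
    qed (rule t0)
    have "0 \<le> infsum ?t I"
      by (rule infsum_nonneg) (rule t0)
    then have "infsum ?t I powr (1 / s) \<le> ((C * N p f) powr s) powr (1 / s)"
      using s(3) infsum_le_finite_sums[OF summ le] by (intro powr_mono2) auto
    also have "\<dots> = C * N p f"
      using s(3) C N_nonneg[OF p(1) f] by (simp add: powr_powr)
    finally show ?thesis
      using summ False by (simp add: lp_space_def lp_norm_def s_simps)
  qed
  show thesis
    by (rule that[OF C syn ana])
qed

end

text \<open>Translates conjugacy of extended exponents into real arithmetic, with the infinite
  exponent arising only at \<open>p = 1\<close>.\<close>

lemma conjugate_exponent_cases:
  fixes p p' :: ennreal
  assumes "1 \<le> p" "p \<le> 2" "1 / p + 1 / p' = 1"
  obtains r where "1 \<le> p'" "p = 1 \<and> p' = \<infinity> \<and> r = (1::real) \<or>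
    (\<exists>s. p = ennreal r \<and> p' = ennreal s \<and> 1 < r \<and> r \<le> 2 \<and> 2 \<le> s \<and> 1 / r + 1 / s = 1)"
proof -
  obtain r where r: "p = ennreal r" "1 \<le> r" "r \<le> 2"
    using assms(1,2)
    by (cases p) (auto simp: top_unique simp flip: ennreal_1 ennreal_numeral)
  have p_inv: "1 / p = ennreal (1 / r)"
    using r divide_ennreal[of 1 r] by simp
  show thesis
  proof (cases p')
    case top
    then have "ennreal (1 / r) = ennreal 1"
      using assms(3) p_inv by simp
    then have "r = 1"
      using r by (simp del: ennreal_1)
    then show thesis
      using that[of 1] r top by simp
  next
    case (real s)
    \<comment> \<open>For extended reals \<open>1 / 0\<close> is infinite, which rules out
      \<open>p' = 0\<close>.\<close>
    have "s \<noteq> 0"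
      using assms(3) real by auto
    then have "0 < s"
      using real by simp
    then have "1 / p' = ennreal (1 / s)"
      using real divide_ennreal[of 1 s] by simp
    then have "ennreal (1 / r + 1 / s) = ennreal 1"
      using assms(3) p_inv r \<open>0 < s\<close> by simp
    then have sum_eq: "1 / r + 1 / s = 1"
      using r \<open>0 < s\<close> by (subst (asm) ennreal_inj) auto
    have "1 / 2 \<le> 1 / r"
      using r by (simp add: field_simps)
    then have "1 / s \<le> 1 / 2"
      using sum_eq by linarith
    then have "2 \<le> s"
      using \<open>0 < s\<close> by (simp add: field_simps)
    have "0 < 1 / s"
      using \<open>0 < s\<close> by simp
    then have "1 / r < 1"
      using sum_eq by linarith
    then have "1 < r"
      using r by simp
    then show thesis
      using \<open>2 \<le> s\<close> r real sum_eq
      by (intro that[of r]) (auto simp flip: ennreal_1)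
  qed
qed

theorem theorem3p5:
  fixes I :: "'i set"
    and u v :: "'i \<Rightarrow> 'h::complex_hilbert_space"
    and X :: "ennreal \<Rightarrow> 'h set"
    and N :: "ennreal \<Rightarrow> 'h \<Rightarrow> real"
    and p p' :: ennreal
  assumes "separable_space (euclidean :: 'h topology)"
    and "countable I"
    and "riesz_basis I u"
    and "biorthogonal I u v"
    and "hp_family X N"
    and "\<And>q \<xi>. 1 \<le> q \<Longrightarrow> \<xi> \<in> I \<Longrightarrow> u \<xi> \<in> X q \<and> v \<xi> \<in> X q"
    and "1 \<le> p" and "p \<le> 2" and "1 / p + 1 / p' = 1"
  shows "\<exists>C\<ge>(1::real).
    (\<forall>f\<in>X p. fourier v f \<in> lp_space I (N \<infinity>) u v p' \<and>
       lp_norm I (N \<infinity>) u v p' (fourier v f) \<le> C * N p f) \<and>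
    (\<forall>a\<in>lp_space I (N \<infinity>) u v p. (\<lambda>\<xi>. a \<xi> *\<^sub>C u \<xi>) summable_on I \<and>
       fourier_inv I u a \<in> X p' \<and>
       N p' (fourier_inv I u a) \<le> C * lp_norm I (N \<infinity>) u v p a) \<and>
    (\<forall>f\<in>X p. fourier u f \<in> lp_space I (N \<infinity>) v u p' \<and>
       lp_norm I (N \<infinity>) v u p' (fourier u f) \<le> C * N p f) \<and>
    (\<forall>b\<in>lp_space I (N \<infinity>) v u p. (\<lambda>\<xi>. b \<xi> *\<^sub>C v \<xi>) summable_on I \<and>
       fourier_inv I v b \<in> X p' \<and>
       N p' (fourier_inv I v b) \<le> C * lp_norm I (N \<infinity>) v u p b)"
proof -
  interpret hp_family X N by fact
  obtain K where "riesz_pair I u v K" "riesz_pair I v u K"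
    using riesz_basis_riesz_pairs[OF assms(3,4)] .
  then interpret U: riesz_hp X N I u v K + V: riesz_hp X N I v u K
    using assms(2,5,6) by (simp_all add: riesz_hp_def riesz_hp_axioms_def)
  obtain r where p': "1 \<le> p'" and exponents: "p = 1 \<and> p' = \<infinity> \<and> r = (1::real) \<or>
      (\<exists>s. p = ennreal r \<and> p' = ennreal s \<and> 1 < r \<and> r \<le> 2 \<and> 2 \<le> s \<and> 1 / r + 1 / s = 1)"
    using conjugate_exponent_cases[OF assms(7-9)] .
  \<comment> \<open>Each order of the pair yields synthesis and analysis by one system:
    \<open>A\<close> serves \<open>u\<close> and \<open>B\<close> serves \<open>v\<close>.\<close>
  obtain A where A: "1 \<le> A"
    "\<And>a. a \<in> lp_space I (N \<infinity>) u v p \<Longrightarrow> (\<lambda>\<xi>. a \<xi> *\<^sub>C u \<xi>) summable_on I \<and>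
      fourier_inv I u a \<in> X p' \<and> N p' (fourier_inv I u a) \<le> A * lp_norm I (N \<infinity>) u v p a"
    "\<And>f. f \<in> X p \<Longrightarrow> fourier u f \<in> lp_space I (N \<infinity>) v u p' \<and>
      lp_norm I (N \<infinity>) v u p' (fourier u f) \<le> A * N p f"
    by (rule U.hausdorff_young[OF assms(7) p' assms(9) exponents]) (rule that)
  obtain B where B: "1 \<le> B"
    "\<And>b. b \<in> lp_space I (N \<infinity>) v u p \<Longrightarrow> (\<lambda>\<xi>. b \<xi> *\<^sub>C v \<xi>) summable_on I \<and>
      fourier_inv I v b \<in> X p' \<and> N p' (fourier_inv I v b) \<le> B * lp_norm I (N \<infinity>) v u p b"
    "\<And>f. f \<in> X p \<Longrightarrow> fourier v f \<in> lp_space I (N \<infinity>) u v p' \<and>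
      lp_norm I (N \<infinity>) u v p' (fourier v f) \<le> B * N p f"
    by (rule V.hausdorff_young[OF assms(7) p' assms(9) exponents]) (rule that)
  have "p \<noteq> \<infinity>"
    using assms(8) by (auto simp: top_unique)
  \<comment> \<open>Nonnegativity allows \<open>A\<close> and \<open>B\<close> to be replaced by
    their maximum.\<close>
  then have lp_norm_nonneg: "0 \<le> lp_norm I (N \<infinity>) x y p a" for x y a
    by (simp add: lp_norm_def)
  have le_A: "c \<le> max A B * d" if "c \<le> A * d" "0 \<le> d" for c d
    using that mult_right_mono[of A "max A B" d] by linarith
  have le_B: "c \<le> max A B * d" if "c \<le> B * d" "0 \<le> d" for c d
    using that mult_right_mono[of B "max A B" d] by linarith
  show ?thesis
  proof (intro exI[of _ "max A B"] conjI ballI)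
    show "1 \<le> max A B"
      using A(1) by simp
    fix f assume "f \<in> X p"
    then show "fourier v f \<in> lp_space I (N \<infinity>) u v p'"
      "fourier u f \<in> lp_space I (N \<infinity>) v u p'"
      "lp_norm I (N \<infinity>) u v p' (fourier v f) \<le> max A B * N p f"
      "lp_norm I (N \<infinity>) v u p' (fourier u f) \<le> max A B * N p f"
      using A(3)[of f] B(3)[of f] le_A le_B N_nonneg[OF assms(7)] by blast+
  next
    fix a assume "a \<in> lp_space I (N \<infinity>) u v p"
    then show "(\<lambda>\<xi>. a \<xi> *\<^sub>C u \<xi>) summable_on I" "fourier_inv I u a \<in> X p'"
      "N p' (fourier_inv I u a) \<le> max A B * lp_norm I (N \<infinity>) u v p a"
      using A(2)[of a] le_A lp_norm_nonneg by blast+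
  next
    fix b assume "b \<in> lp_space I (N \<infinity>) v u p"
    then show "(\<lambda>\<xi>. b \<xi> *\<^sub>C v \<xi>) summable_on I" "fourier_inv I v b \<in> X p'"
      "N p' (fourier_inv I v b) \<le> max A B * lp_norm I (N \<infinity>) v u p b"
      using B(2)[of b] le_B lp_norm_nonneg by blast+
  qed
qed

end
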